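(* Let $V_{1,H}\subset\prod_{k\in I_1}\mathcal F$ and $V_{2,H}\subset\prod_{k\in I_2}\mathcal F$ be finite-dimensional subspaces, let $m_{ij},a_{ij},c_{ij}$ ($i,j\in\{1,2\}$) be the bilinear forms defined in the context, and let $\gamma$ be the constant defined in the context. Let $\tau>0$ and let $(U_1^n)_{n\ge 0}\subset V_{1,H}$, $(U_2^n)_{n\ge0}\subset V_{2,H}$ satisfy, for every $n\ge 1$, the following scheme (discretization scheme 1 with zero source): for all $W_1\in V_{1,H}$, $$m_{11}\Big(\frac{U_1^{n+1}-U_1^n}{\tau},W_1\Big)+m_{12}\Big(\frac{U_2^{n}-U_2^{n-1}}{\tau},W_1\Big)+a_{11}(U_1^{n+1},W_1)+a_{12}(U_2^n,W_1)+c_{11}(U_1^{n+1},W_1)+c_{12}(U_2^{n+1},W_1)=0,$$ and for all $W_2\in V_{2,H}$, $$m_{22}\Big(\frac{U_2^{n+1}-U_2^n}{\tau},W_2\Big)+m_{21}\Big(\frac{U_1^{n}-U_1^{n-1}}{\tau},W_2\Big)+a_{21}(U_1^{n+1},W_2)+a_{22}(U_2^n,W_2)+c_{21}(U_1^{n+1},W_2)+c_{22}(U_2^{n+1},W_2)=0.$$ If $$\tau\le(1-\gamma^2)\inf_{W\in V_{2,H}}\frac{\|W\|_{m_{22}}^2}{\|W\|_{a_{22}}^2},$$ then for every $n\ge1$ $$\frac{\gamma^2}{\tau}\sum_{i=1}^2\|U_i^{n+1}-U_i^n\|_{m_{ii}}^2+\|(U_1^{n+1},U_2^{n+1})\|_a^2+\|(U_1^{n+1},U_2^{n+1})\|_c^2\le\frac{\gamma^2}{\tau}\sum_{i=1}^2\|U_i^{n}-U_i^{n-1}\|_{m_{ii}}^2+\|(U_1^{n},U_2^{n})\|_a^2+\|(U_1^{n},U_2^{n})\|_c^2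 .$$
   Context: Setting. $\Omega\subset\mathbb R^d$ ($d=2,3$) is a bounded polygonal domain and $\kappa:\Omega\to\mathbb R$ satisfies $0<\min\kappa\le\kappa(x)\le\max\kappa<\infty$. $\Omega$ is partitioned by a regular coarse mesh $\mathcal T_H$; $I_H$ is the set of centers of the coarse blocks and $K_H(x_l)$ is the block with center $x_l\in I_H$. $(\cdot,\cdot)$ and $\|\cdot\|$ are the $L^2(\Omega)$ inner product and norm, and $a(u,v)=\int_\Omega\kappa\nabla u\cdot\nabla v$, where for functions that are only piecewise regular on the coarse mesh the gradients are taken block by block. Continua and basis functions. There are $N$ continua with given auxiliary functions $\psi_1,\dots,\psi_N$ (e.g. characteristic functions of the continua). For each coarse block $K=K_H(x_l)$, let $K^+$ be an oversampled region around $K$ composed of coarse blocks $K^p$, with $K=K^{p_0}$, and write $\psi_j^p$ for $\psi_j$ on $K^p$. The functions $\phi_i=\phi_i^{K}$ and $\phi_i^m=\phi_i^{K,m}$ ($1\le i\le N$, $1\le m\le d$), in the local energy space on $K^+$ (contained in $H^1(K^+)$), solve, with Lagrange multipliers $\mu$ and for all test functions $v$ in the local energy space: (1) $\int_{K^+}\kappa\nabla\phi_i\cdot\nabla v-\sum_{j,p}\frac{\mu_{ij}^p}{\int_{K^p}\psi_j^p}\int_{K^p}\psi_j^pv=0$ and $\int_{K^p}\phi_i\psi_j^p=\delta_{ij}\int_{K^p}\psi_j^p$ for all $j,p$; (2) $\int_{K^+}\kappa\nabla\phi_i^m\cdot\nabla v-\sum_{j,p}\frac{\mu_{ij}^{mp}}{\int_{K^p}\psi_j^p}\int_{K^p}\psi_j^pv=0$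 and $\int_{K^p}\phi_i^m\psi_j^p=\delta_{ij}\int_{K^p}(x_m-\tilde x_m)\psi_j^p$ for all $j,p$, where the constant $\tilde x_m$ is such that $\int_{K^{p_0}}(x_m-\tilde x_m)\psi_j^{p_0}=0$. Write $\tilde\phi_i^{K}=(\phi_i^{K,m})_{1\le m\le d}$. Spaces and maps. $\mathcal F=\mathcal F(\Omega)$ is a vector space of sufficiently smooth functions on $\Omega$ (e.g. $H^{1+\alpha}_0(\Omega)$ for some $\alpha\in(0,1]$). $I_1,I_2$ are disjoint sets with $I_1\cup I_2=\{1,\dots,N\}$. For $j=1,2$ and $U=(U_i)_{i\in I_j}\in\prod_{i\in I_j}\mathcal F$ define $$T_{j,0}U=\sum_{i\in I_j}\sum_{x_l\in I_H}\mathbf 1_{K_H(x_l)}\phi_i^{K_H(x_l)}U_i,\qquad T_{j,1}U=\sum_{i\in I_j}\sum_{x_l\in I_H}\mathbf 1_{K_H(x_l)}\tilde\phi_i^{K_H(x_l)}\cdot\nabla U_i,\qquad T_j=T_{j,0}+T_{j,1},$$ and $V_j=T_j\big(\prod_{i\in I_j}\mathcal F\big)$. The multicontinuum space is the direct sum $V_1\oplus V_2$; in particular $V_1\cap V_2=\{0\}$. The finite-dimensional spaces $V_{j,H}$ (e.g. Lagrange finite element spaces) are regular enough that all forms below are defined on them, and $T_j(V_{j,H})\subset L^2(\Omega)$. Forms and norms. For $U\in\prod_{k\in I_j}\mathcal F$ and $W\in\prod_{k\in I_i}\mathcal F$, $$m_{ij}(U,W)=(T_jU,T_iW),\quad a_{ij}(U,W)=a(T_{j,1}U,T_{i,1}W),\quad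 c_{ij}(U,W)=a(T_{j,0}U,T_{i,0}W).$$ $\|W\|_{m_{ii}}^2=m_{ii}(W,W)$, $\|W\|_{a_{ii}}^2=a_{ii}(W,W)$, $\|W\|_{c_{ii}}^2=c_{ii}(W,W)$, and $$\|(U_1,U_2)\|_a^2=\sum_{i,j}a_{ij}(U_j,U_i)=a\Big(\sum_iT_{i,1}U_i,\sum_iT_{i,1}U_i\Big),\qquad\|(U_1,U_2)\|_c^2=\sum_{i,j}c_{ij}(U_j,U_i)=a\Big(\sum_iT_{i,0}U_i,\sum_iT_{i,0}U_i\Big).$$ The constant $\gamma$ is $$\gamma=\sup_{U_1\in V_{1,H},\,U_2\in V_{2,H}}\frac{(T_1U_1,T_2U_2)}{\|T_1U_1\|\,\|T_2U_2\|}$$ (supremum over pairs with nonzero denominator); by $V_1\cap V_2=\{0\}$ and finite dimensionality, $\gamma<1$. The infimum of quotients over $V_{2,H}$ is over $W$ with nonzero denominator. *)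

theory Defs
  imports "HOL-Analysis.Analysis" "HOL-Library.Function_Algebras"
begin

section \<open>Real function spaces and Sobolev spaces of order one\<close>

text \<open>
  Addition and subtraction of functions are pointwise (from Function_Algebras); the pointwise
  scalar multiplication makes subspace and span available for spaces of functions.
\<close>

instantiation "fun" :: (type, real_vector) real_vector
begin

definition scaleR_fun_def: "c *\<^sub>R f = (\<lambda>x. c *\<^sub>R f x)"

instance
  by standard (simp_all add: scaleR_fun_def plus_fun_def fun_eq_iff algebra_simps)

end

definition L2 :: "'a::euclidean_space set \<Rightarrow> ('a \<Rightarrow> 'b::euclidean_space) set" where
  "L2 S = {f \<in> borel_measurable (lebesgue_on S). integrable (lebesgue_on S) (\<lambda>x. (norm (f x))\<^sup>2)}"

definition L2_inner :: "'a::euclidean_space set \<Rightarrow> ('a \<Rightarrow> real) \<Rightarrow> ('a \<Rightarrow> real) \<Rightarrow> real" where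
  "L2_inner S f g = (LINT x|lebesgue_on S. f x * g x)"

definition L2_norm :: "'a::euclidean_space set \<Rightarrow> ('a \<Rightarrow> real) \<Rightarrow> real" where
  "L2_norm S f = sqrt (L2_inner S f f)"

text \<open>
  Continuously differentiable test functions with compact support in the open set \<open>S\<close>, paired
  with their gradients.
\<close>

definition test_functions :: "'a::euclidean_space set \<Rightarrow> (('a \<Rightarrow> real) \<times> ('a \<Rightarrow> 'a)) set" where
  "test_functions S = {(v, G). (\<forall>x. GDERIV v x :> G x) \<and> continuous_on UNIV G \<and>
     compact (closure {x. v x \<noteq> 0}) \<and> closure {x. v x \<noteq> 0} \<subseteq> S}"

definition is_weak_grad ::
    "'a::euclidean_space set \<Rightarrow> ('a \<Rightarrow> real) \<Rightarrow> ('a \<Rightarrow> 'a) \<Rightarrow> bool" where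
  "is_weak_grad S f g \<longleftrightarrow> (\<forall>(v, G) \<in> test_functions S.
     (LINT x|lebesgue_on S. f x *\<^sub>R G x) = - (LINT x|lebesgue_on S. v x *\<^sub>R g x))"

definition H1 :: "'a::euclidean_space set \<Rightarrow> ('a \<Rightarrow> real) set" where
  "H1 S = {f \<in> L2 S. \<exists>g \<in> L2 S. is_weak_grad S f g}"

text \<open>For \<open>f \<in> H1 S\<close> this is determined almost everywhere on \<open>S\<close>.\<close>

definition weak_grad :: "'a::euclidean_space set \<Rightarrow> ('a \<Rightarrow> real) \<Rightarrow> 'a \<Rightarrow> 'a" where
  "weak_grad S f = (SOME g. g \<in> L2 S \<and> is_weak_grad S f g)"

section \<open>Domain and coarse mesh\<close>

text \<open>
  A polygonal (polyhedral) domain is the interior of a finite union of convex polytopes; this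
  excludes slits.
\<close>

definition polygonal_domain :: "'a::euclidean_space set \<Rightarrow> bool" where
  "polygonal_domain S \<longleftrightarrow> open S \<and> connected S \<and> S \<noteq> {} \<and> bounded S \<and>
     (\<exists>P. finite P \<and> (\<forall>p\<in>P. polytope p) \<and> S = interior (\<Union>P))"

text \<open>Blocks are closed, full-dimensional, and meet face to face (no hanging nodes).\<close>

definition regular_mesh :: "'a::euclidean_space set \<Rightarrow> 'a set set \<Rightarrow> bool" where
  "regular_mesh S T \<longleftrightarrow> finite T \<and> \<Union>T = closure S \<and>
     (\<forall>K\<in>T. polytope K \<and> interior K \<noteq> {}) \<and>
     (\<forall>K\<in>T. \<forall>K'\<in>T. (K \<inter> K') face_of K \<and> (K \<inter> K') face_of K')"

definition block_center :: "'a::euclidean_space set \<Rightarrow> 'a" where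
  "block_center K = (LINT x|lebesgue_on K. x) /\<^sub>R measure lebesgue K"

definition broken_H1 :: "'a::euclidean_space set set \<Rightarrow> ('a \<Rightarrow> real) set" where
  "broken_H1 T = {u. \<forall>K\<in>T. u \<in> H1 (interior K)}"

text \<open>The energy form with gradients taken block by block.\<close>

definition broken_energy ::
    "('a::euclidean_space \<Rightarrow> real) \<Rightarrow> 'a set set \<Rightarrow> ('a \<Rightarrow> real) \<Rightarrow> ('a \<Rightarrow> real) \<Rightarrow> real" where
  "broken_energy \<kappa> T u v = (\<Sum>K\<in>T. LINT x|lebesgue_on (interior K).
     \<kappa> x * (weak_grad (interior K) u x \<bullet> weak_grad (interior K) v x))"

section \<open>Multicontinuum data\<close>

text \<open>
  \<open>block x\<close> is the coarse block with center \<open>x\<close>; \<open>patch K\<close> is the set of blocks composing the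
  oversampled region around \<open>K\<close>; \<open>energy_space K\<close> is the local energy space on that region;
  \<open>smooth_fns\<close> is the space of macroscopic functions; \<open>group 1\<close> and \<open>group 2\<close> split the
  continua \<open>1, \<dots>, ncont\<close>.
\<close>

record ('n::finite) mc_data =
  domain :: "(real^'n) set"
  kappa :: "real^'n \<Rightarrow> real"
  mesh :: "(real^'n) set set"
  centers :: "(real^'n) set"
  block :: "real^'n \<Rightarrow> (real^'n) set"
  patch :: "(real^'n) set \<Rightarrow> (real^'n) set set"
  ncont :: nat
  psi :: "nat \<Rightarrow> real^'n \<Rightarrow> real"
  energy_space :: "(real^'n) set \<Rightarrow> (real^'n \<Rightarrow> real) set"
  phi :: "(real^'n) set \<Rightarrow> nat \<Rightarrow> real^'n \<Rightarrow> real"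
  phi_grad :: "(real^'n) set \<Rightarrow> nat \<Rightarrow> 'n \<Rightarrow> real^'n \<Rightarrow> real"
  smooth_fns :: "(real^'n \<Rightarrow> real) set"
  group :: "nat \<Rightarrow> nat set"

definition oversampled :: "'n::finite mc_data \<Rightarrow> (real^'n) set \<Rightarrow> (real^'n) set" where
  "oversampled D K = interior (\<Union>(patch D K))"

text \<open>
  Common form of the two local saddle point problems: \<open>u\<close> has minimal energy subject to the
  constraints that its moment against \<open>psi j\<close> on the block \<open>P\<close> is \<open>t j P\<close>; \<open>\<mu>\<close> are the Lagrange
  multipliers.
\<close>

definition solves_local_problem ::
    "'n::finite mc_data \<Rightarrow> (real^'n) set \<Rightarrow> (nat \<Rightarrow> (real^'n) set \<Rightarrow> real) \<Rightarrow> (real^'n \<Rightarrow> real) \<Rightarrow> bool"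
  where
  "solves_local_problem D K t u \<longleftrightarrow> u \<in> energy_space D K \<and>
     (\<exists>\<mu>. \<forall>v\<in>energy_space D K.
        (LINT x|lebesgue_on (oversampled D K). kappa D x *
            (weak_grad (oversampled D K) u x \<bullet> weak_grad (oversampled D K) v x))
        - (\<Sum>j\<in>{1..ncont D}. \<Sum>P\<in>patch D K.
             \<mu> j P / (LINT x|lebesgue_on P. psi D j x) * (LINT x|lebesgue_on P. psi D j x * v x))
        = 0) \<and>
     (\<forall>j\<in>{1..ncont D}. \<forall>P\<in>patch D K. (LINT x|lebesgue_on P. u x * psi D j x) = t j P)"

text \<open>
  The constant \<open>\<xi>\<close> below depends on the continuum \<open>j\<close>. Because of the Kronecker delta only its
  value for \<open>j = i\<close> matters.
\<close>

locale multicontinuum =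
  fixes D :: "'n::finite mc_data"
  assumes dimension: "CARD('n) = 2 \<or> CARD('n) = 3"
    and domain: "polygonal_domain (domain D)"
    and kappa_measurable: "kappa D \<in> borel_measurable (lebesgue_on (domain D))"
    and kappa_bounds:
      "\<exists>kmin kmax. 0 < kmin \<and> (\<forall>x\<in>domain D. kmin \<le> kappa D x \<and> kappa D x \<le> kmax)"
    and mesh: "regular_mesh (domain D) (mesh D)"
    and blocks: "bij_betw (block D) (centers D) (mesh D)"
    and centers: "\<forall>x\<in>centers D. block_center (block D x) = x"
    and patches: "\<forall>K\<in>mesh D. K \<in> patch D K \<and> patch D K \<subseteq> mesh D"
    and psi_L2: "\<forall>j\<in>{1..ncont D}. psi D j \<in> L2 (domain D)"
    and psi_nonzero: "\<forall>j\<in>{1..ncont D}. \<forall>K\<in>mesh D. (LINT x|lebesgue_on K. psi D j x) \<noteq> 0"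
    and energy_space:
      "\<forall>K\<in>mesh D. subspace (energy_space D K) \<and> energy_space D K \<subseteq> H1 (oversampled D K)"
    and phi: "\<forall>K\<in>mesh D. \<forall>i\<in>{1..ncont D}.
      solves_local_problem D K
        (\<lambda>j P. if i = j then (LINT x|lebesgue_on P. psi D j x) else 0) (phi D K i)"
    and phi_grad: "\<forall>K\<in>mesh D. \<forall>i\<in>{1..ncont D}. \<forall>m. \<exists>\<xi>.
      (\<forall>j\<in>{1..ncont D}. (LINT x|lebesgue_on K. (x $ m - \<xi> j) * psi D j x) = 0) \<and>
      solves_local_problem D K
        (\<lambda>j P. if i = j then (LINT x|lebesgue_on P. (x $ m - \<xi> j) * psi D j x) else 0)
        (phi_grad D K i m)"
    and smooth_fns: "subspace (smooth_fns D)" "smooth_fns D \<subseteq> H1 (domain D)"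
    and groups: "group D 1 \<inter> group D 2 = {}" "group D 1 \<union> group D 2 = {1..ncont D}"

section \<open>Downscaling maps, forms and norms\<close>

text \<open>
  The product of copies of \<open>smooth_fns\<close> over \<open>group j\<close>: families indexed by all natural numbers
  that vanish outside the group.
\<close>

definition macro_space :: "'n::finite mc_data \<Rightarrow> nat \<Rightarrow> (nat \<Rightarrow> real^'n \<Rightarrow> real) set" where
  "macro_space D j = {U. (\<forall>i\<in>group D j. U i \<in> smooth_fns D) \<and> (\<forall>i. i \<notin> group D j \<longrightarrow> U i = 0)}"

definition T0 :: "'n::finite mc_data \<Rightarrow> nat \<Rightarrow> (nat \<Rightarrow> real^'n \<Rightarrow> real) \<Rightarrow> real^'n \<Rightarrow> real" where
  "T0 D j U x = (\<Sum>i\<in>group D j. \<Sum>l\<in>centers D. indicat_real (block D l) x *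
     phi D (block D l) i x * U i x)"

definition T1 :: "'n::finite mc_data \<Rightarrow> nat \<Rightarrow> (nat \<Rightarrow> real^'n \<Rightarrow> real) \<Rightarrow> real^'n \<Rightarrow> real" where
  "T1 D j U x = (\<Sum>i\<in>group D j. \<Sum>l\<in>centers D. indicat_real (block D l) x *
     ((\<chi> m. phi_grad D (block D l) i m x) \<bullet> weak_grad (domain D) (U i) x))"

definition T :: "'n::finite mc_data \<Rightarrow> nat \<Rightarrow> (nat \<Rightarrow> real^'n \<Rightarrow> real) \<Rightarrow> real^'n \<Rightarrow> real" where
  "T D j U = T0 D j U + T1 D j U"

text \<open>The intersection of \<open>V\<^sub>1\<close> and \<open>V\<^sub>2\<close> is trivial, as spaces of functions modulo null sets.\<close>

definition direct_sum_V :: "'n::finite mc_data \<Rightarrow> bool" where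
  "direct_sum_V D \<longleftrightarrow> (\<forall>U\<in>macro_space D 1. \<forall>W\<in>macro_space D 2.
     (AE x in lebesgue_on (domain D). T D 1 U x = T D 2 W x) \<longrightarrow>
     (AE x in lebesgue_on (domain D). T D 1 U x = 0))"

text \<open>In the forms, the first function \<open>U\<close> belongs to group \<open>j\<close> and the second \<open>W\<close> to group \<open>i\<close>.\<close>

definition m_form ::
    "'n::finite mc_data \<Rightarrow> nat \<Rightarrow> nat \<Rightarrow> (nat \<Rightarrow> real^'n \<Rightarrow> real) \<Rightarrow> (nat \<Rightarrow> real^'n \<Rightarrow> real) \<Rightarrow> real"
  where "m_form D i j U W = L2_inner (domain D) (T D j U) (T D i W)"

definition a_form ::
    "'n::finite mc_data \<Rightarrow> nat \<Rightarrow> nat \<Rightarrow> (nat \<Rightarrow> real^'n \<Rightarrow> real) \<Rightarrow> (nat \<Rightarrow> real^'n \<Rightarrow> real) \<Rightarrow> real"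
  where "a_form D i j U W = broken_energy (kappa D) (mesh D) (T1 D j U) (T1 D i W)"

definition c_form ::
    "'n::finite mc_data \<Rightarrow> nat \<Rightarrow> nat \<Rightarrow> (nat \<Rightarrow> real^'n \<Rightarrow> real) \<Rightarrow> (nat \<Rightarrow> real^'n \<Rightarrow> real) \<Rightarrow> real"
  where "c_form D i j U W = broken_energy (kappa D) (mesh D) (T0 D j U) (T0 D i W)"

text \<open>Squared norms.\<close>

definition m_norm2 :: "'n::finite mc_data \<Rightarrow> nat \<Rightarrow> (nat \<Rightarrow> real^'n \<Rightarrow> real) \<Rightarrow> real" where
  "m_norm2 D i W = m_form D i i W W"

definition a_norm2 :: "'n::finite mc_data \<Rightarrow> nat \<Rightarrow> (nat \<Rightarrow> real^'n \<Rightarrow> real) \<Rightarrow> real" where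
  "a_norm2 D i W = a_form D i i W W"

text \<open>Squared norms of a pair \<open>(U 1, U 2)\<close>.\<close>

definition a_pair_norm2 :: "'n::finite mc_data \<Rightarrow> (nat \<Rightarrow> nat \<Rightarrow> real^'n \<Rightarrow> real) \<Rightarrow> real" where
  "a_pair_norm2 D U = (\<Sum>i\<in>{1, 2}. \<Sum>j\<in>{1, 2}. a_form D i j (U j) (U i))"

definition c_pair_norm2 :: "'n::finite mc_data \<Rightarrow> (nat \<Rightarrow> nat \<Rightarrow> real^'n \<Rightarrow> real) \<Rightarrow> real" where
  "c_pair_norm2 D U = (\<Sum>i\<in>{1, 2}. \<Sum>j\<in>{1, 2}. c_form D i j (U j) (U i))"

section \<open>Discrete spaces\<close>

definition discrete_space ::
    "'n::finite mc_data \<Rightarrow> nat \<Rightarrow> (nat \<Rightarrow> real^'n \<Rightarrow> real) set \<Rightarrow> bool" where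
  "discrete_space D j V \<longleftrightarrow> V \<subseteq> macro_space D j \<and> (\<exists>B. finite B \<and> V = span B) \<and>
     (\<forall>U\<in>V. T D j U \<in> L2 (domain D) \<and> T0 D j U \<in> broken_H1 (mesh D) \<and>
        T1 D j U \<in> broken_H1 (mesh D))"

text \<open>
  If there is no pair with nonzero denominator, the supremum (of a set of cosines, closed under
  negation) is taken to be 0.
\<close>

definition gamma ::
    "'n::finite mc_data \<Rightarrow> (nat \<Rightarrow> real^'n \<Rightarrow> real) set \<Rightarrow> (nat \<Rightarrow> real^'n \<Rightarrow> real) set \<Rightarrow> real" where
  "gamma D V1 V2 =
     (let Q = {L2_inner (domain D) (T D 1 U1) (T D 2 U2) /
                 (L2_norm (domain D) (T D 1 U1) * L2_norm (domain D) (T D 2 U2)) | U1 U2.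
               U1 \<in> V1 \<and> U2 \<in> V2 \<and>
               L2_norm (domain D) (T D 1 U1) * L2_norm (domain D) (T D 2 U2) \<noteq> 0}
      in if Q = {} then 0 else Sup Q)"

text \<open>The infimum is taken in the extended reals, so that it is infinite over the empty set.\<close>

definition inf_quotient ::
    "'n::finite mc_data \<Rightarrow> (nat \<Rightarrow> real^'n \<Rightarrow> real) set \<Rightarrow> ereal" where
  "inf_quotient D V2 =
     (INF W \<in> {W \<in> V2. a_norm2 D 2 W \<noteq> 0}. ereal (m_norm2 D 2 W / a_norm2 D 2 W))"

end

theory Submission
  imports Defs
begin

text \<open>
  Test the two equations with the increments \<open>d\<^sub>i = U\<^sub>i\<^sup>n\<^sup>+\<^sup>1 - U\<^sub>i\<^sup>n\<close> and add. The lagged mass coupling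
  between \<open>d\<^sub>i\<close> and \<open>e\<^sub>j = U\<^sub>j\<^sup>n - U\<^sub>j\<^sup>n\<^sup>-\<^sup>1\<close> is at most \<open>(\<gamma>\<^sup>2 |e\<^sub>j|\<^sup>2 + |d\<^sub>i|\<^sup>2) / 2\<close> by the definition of \<open>\<gamma>\<close>
  and Young's inequality. Polarization turns the implicit form \<open>c\<close> into a difference of energies
  plus \<open>|(d\<^sub>1, d\<^sub>2)|\<^sub>c\<^sup>2 / 2\<close>; treating the second component explicitly in \<open>a\<close> leaves
  \<open>(|d\<^sub>1|\<^sub>a\<^sup>2 - |d\<^sub>2|\<^sub>a\<^sup>2) / 2\<close> instead, and the bound on \<open>\<tau>\<close> absorbs the negative term into
  \<open>(1 - \<gamma>\<^sup>2) |d\<^sub>2|\<^sup>2 / (2 \<tau>)\<close>.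

  All of this needs bilinearity of the forms, and hence additivity of the weak gradient. As
  \<open>weak_grad\<close> is chosen by \<open>SOME\<close>, that rests on almost everywhere uniqueness, which is the
  fundamental lemma of the calculus of variations for \<open>C\<^sup>1\<close> test functions.
\<close>

section \<open>The fundamental lemma of the calculus of variations\<close>

lemma test_functionsI:
  assumes "\<And>x. GDERIV v x :> G x" "continuous_on UNIV G" "compact K" "K \<subseteq> S" "\<And>x. x \<notin> K \<Longrightarrow> v x = 0"
  shows "(v, G) \<in> test_functions S"
proof -
  have "closure {x. v x \<noteq> 0} \<subseteq> K"
    using assms by (intro closure_minimal compact_imp_closed) auto
  then show ?thesis
    using assms compact_Int_closed[OF \<open>compact K\<close> closed_closure[of "{x. v x \<noteq> 0}"]]
    by (auto simp: test_functions_def Int_absorb1)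
qed

lemma test_functionsD:
  assumes "(v, G) \<in> test_functions S"
  shows "GDERIV v x :> G x" "continuous_on UNIV G" "compact (closure {x. v x \<noteq> 0})"
    "closure {x. v x \<noteq> 0} \<subseteq> S"
  using assms unfolding test_functions_def by auto

lemma test_function_zero: "((\<lambda>x. 0), (\<lambda>x. 0)) \<in> test_functions S"
  by (rule test_functionsI[of _ _ "{}"]) (auto simp: GDERIV_const)

lemma test_function_continuous:
  assumes "(v, G) \<in> test_functions S"
  shows "continuous_on UNIV v"
proof -
  have "isCont v x" for x
    using test_functionsD(1)[OF assms, of x] unfolding gderiv_def by (rule has_derivative_continuous)
  then show ?thesis by (simp add: continuous_at_imp_continuous_on)
qed

text \<open>Off its closed support \<open>v\<close> is zero on an open neighbourhood, so there its
  derivative is that of the zero function. Bounds for \<open>v\<close> and \<open>G\<close> are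
  thereby reduced to a compact set.\<close>

lemma test_function_eq_0:
  assumes "(v, G) \<in> test_functions S" "x \<notin> closure {x. v x \<noteq> 0}"
  shows "v x = 0" "G x = 0"
proof -
  let ?K = "closure {x. v x \<noteq> 0}"
  show "v x = 0" using assms(2) closure_subset[of "{x. v x \<noteq> 0}"] by auto
  have "((\<lambda>x. 0) has_derivative (\<lambda>h. h \<bullet> G x)) (at x)"
  proof (rule has_derivative_transform_within_open)
    show "(v has_derivative (\<lambda>h. h \<bullet> G x)) (at x)"
      using test_functionsD(1)[OF assms(1)] unfolding gderiv_def .
    show "open (- ?K)" "x \<in> - ?K" using assms(2) by auto
    show "\<And>y. y \<in> - ?K \<Longrightarrow> v y = 0" using closure_subset[of "{x. v x \<noteq> 0}"] by auto
  qed
  then have "(\<lambda>h. h \<bullet> G x) = (\<lambda>h. 0)"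
    using has_derivative_unique has_derivative_const by blast
  then show "G x = 0" by (metis inner_eq_zero_iff)
qed

lemma test_function_bounded:
  assumes "(v, G) \<in> test_functions S"
  shows "\<exists>B. \<forall>x. \<bar>v x\<bar> \<le> B" "\<exists>B. \<forall>x. norm (G x) \<le> B"
proof -
  let ?K = "closure {x. v x \<noteq> 0}"
  note K = test_functionsD(3)[OF assms] and zero = test_function_eq_0[OF assms]
  have "bounded (v ` ?K)" "bounded (G ` ?K)"
    using K test_function_continuous[OF assms] test_functionsD(2)[OF assms]
    by (auto intro!: compact_imp_bounded compact_continuous_image intro: continuous_on_subset)
  then obtain B C where "\<And>x. x \<in> ?K \<Longrightarrow> \<bar>v x\<bar> \<le> B" "\<And>x. x \<in> ?K \<Longrightarrow> norm (G x) \<le> C"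
    unfolding bounded_iff by auto
  then have "\<bar>v x\<bar> \<le> max 0 B" "norm (G x) \<le> max 0 C" for x
    using zero[of x] by (cases "x \<in> ?K"; simp add: max.coboundedI2)+
  then show "\<exists>B. \<forall>x. \<bar>v x\<bar> \<le> B" "\<exists>B. \<forall>x. norm (G x) \<le> B" by blast+
qed

lemma test_function_add:
  assumes "(v, G) \<in> test_functions S" "(w, H) \<in> test_functions S"
  shows "((\<lambda>x. v x + w x), (\<lambda>x. G x + H x)) \<in> test_functions S"
proof (rule test_functionsI)
  let ?K = "closure {x. v x \<noteq> 0} \<union> closure {x. w x \<noteq> 0}"
  show "compact ?K" "?K \<subseteq> S"
    using test_functionsD(3,4)[OF assms(1)] test_functionsD(3,4)[OF assms(2)]
    by (auto simp only: intro!: compact_Un)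
  show "v x + w x = 0" if "x \<notin> ?K" for x
    using that test_function_eq_0(1)[OF assms(1), of x] test_function_eq_0(1)[OF assms(2), of x] by simp
  show "\<And>x. GDERIV (\<lambda>x. v x + w x) x :> G x + H x"
    by (intro GDERIV_add test_functionsD(1)[OF assms(1)] test_functionsD(1)[OF assms(2)])
  show "continuous_on UNIV (\<lambda>x. G x + H x)"
    by (intro continuous_on_add test_functionsD(2)[OF assms(1)] test_functionsD(2)[OF assms(2)])
qed

text \<open>Squaring removes the kink of the positive part, so composition with this function
  preserves C^1 regularity; at 0 the difference quotient is at most |h|.\<close>

lemma DERIV_max_0_squared: "DERIV (\<lambda>t::real. (max 0 t)\<^sup>2) t :> 2 * max 0 t"
proof (cases "t = 0")
  case True
  have "((\<lambda>h::real. (max 0 h)\<^sup>2 / h) \<longlongrightarrow> 0) (at 0)"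
  proof (rule Lim_null_comparison)
    show "\<forall>\<^sub>F h in at (0::real). norm ((max 0 h)\<^sup>2 / h) \<le> \<bar>h\<bar>"
      by (auto intro!: always_eventually simp: max_def power2_eq_square)
    show "((\<lambda>h::real. \<bar>h\<bar>) \<longlongrightarrow> 0) (at 0)"
      using tendsto_rabs_zero[OF tendsto_ident_at] by auto
  qed
  then show ?thesis using True by (simp add: has_field_derivative_iff)
next
  case False
  show ?thesis
  proof (cases "t > 0")
    case True
    have "DERIV (\<lambda>t::real. t\<^sup>2) t :> 2 * t" by (rule derivative_eq_intros refl | simp)+
    then have "DERIV (\<lambda>t::real. (max 0 t)\<^sup>2) t :> 2 * t"
      by (rule has_field_derivative_transform_within_open[of _ _ _ "{0<..}"]) (use True in auto)
    then show ?thesis using True by simp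
  next
    case False
    then have "t < 0" using \<open>t \<noteq> 0\<close> by simp
    have "DERIV (\<lambda>t::real. 0) t :> 0" by simp
    then have "DERIV (\<lambda>t::real. (max 0 t)\<^sup>2) t :> 0"
      by (rule has_field_derivative_transform_within_open[of _ _ _ "{..<0}"]) (use \<open>t < 0\<close> in auto)
    then show ?thesis using \<open>t < 0\<close> by simp
  qed
qed

text \<open>The squared positive part of r^2 - |x - c|^2 works. Knowing its nonzero set exactly is
  what lets sums of bumps represent finite unions of balls.\<close>

lemma ball_bump:
  fixes c :: "'a::euclidean_space"
  assumes "0 < r" "cball c r \<subseteq> S"
  obtains w G where "(w, G) \<in> test_functions S" "\<And>x. 0 \<le> w x" "{x. w x \<noteq> 0} = ball c r"
proof -
  let ?q = "\<lambda>x. r\<^sup>2 - (x - c) \<bullet> (x - c)"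
  let ?w = "\<lambda>x. (max 0 (?q x))\<^sup>2"
  let ?G = "\<lambda>x. (2 * max 0 (?q x)) *\<^sub>R ((-2) *\<^sub>R (x - c))"
  have q: "?q x > 0 \<longleftrightarrow> x \<in> ball c r" for x
  proof -
    have "(x - c) \<bullet> (x - c) = (dist c x)\<^sup>2"
      by (metis dist_commute dist_norm power2_norm_eq_inner)
    moreover have "(dist c x)\<^sup>2 < r\<^sup>2 \<longleftrightarrow> dist c x < r"
      using assms(1) power_less_imp_less_base[of "dist c x" 2 r] power_strict_mono[of "dist c x" r 2] by auto
    ultimately show ?thesis by simp
  qed
  have "(?w, ?G) \<in> test_functions S"
  proof (rule test_functionsI)
    show "GDERIV ?w x :> ?G x" for x
    proof (rule GDERIV_DERIV_compose[OF _ DERIV_max_0_squared])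
      show "GDERIV ?q x :> (-2) *\<^sub>R (x - c)"
        unfolding gderiv_def
        by (rule derivative_eq_intros refl)+ (simp add: inner_commute algebra_simps)
    qed
    show "continuous_on UNIV ?G" by (intro continuous_intros)
    show "compact (cball c r)" "cball c r \<subseteq> S" using assms by simp_all
    show "?w x = 0" if "x \<notin> cball c r" for x
      using that q[of x] by auto
  qed
  moreover have "?w x \<noteq> 0 \<longleftrightarrow> x \<in> ball c r" for x using q[of x] by (auto simp: max_def)
  then have "{x. ?w x \<noteq> 0} = ball c r" by blast
  ultimately show thesis by (intro that[of ?w ?G]) simp_all
qed

text \<open>As \<open>e\<close> decreases to 0 these functions increase to the indicator of the set
  where \<open>v\<close> is nonzero, with values in [0, 1). The new gradient comes from the
  derivative e / (e + t)^2 of t / (e + t).\<close>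

lemma test_function_saturate:
  assumes v: "(v, G) \<in> test_functions S" and "\<And>x. 0 \<le> v x" and "e > 0"
  shows "((\<lambda>x. v x * inverse (e + v x)), (\<lambda>x. (e * (inverse (e + v x))\<^sup>2) *\<^sub>R G x)) \<in> test_functions S"
proof (rule test_functionsI)
  let ?K = "closure {x. v x \<noteq> 0}"
  have ne: "e + v x \<noteq> 0" for x using assms(2)[of x] assms(3) by linarith
  show "GDERIV (\<lambda>x. v x * inverse (e + v x)) x :> (e * (inverse (e + v x))\<^sup>2) *\<^sub>R G x" for x
  proof (rule GDERIV_DERIV_compose[OF test_functionsD(1)[OF v]])
    show "DERIV (\<lambda>t. t * inverse (e + t)) (v x) :> e * (inverse (e + v x))\<^sup>2"
      using ne[of x] by (auto intro!: derivative_eq_intros simp: field_simps power2_eq_square)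
  qed
  show "continuous_on UNIV (\<lambda>x. (e * (inverse (e + v x))\<^sup>2) *\<^sub>R G x)"
    using ne test_functionsD(2)[OF v] test_function_continuous[OF v] by (intro continuous_intros) auto
  show "compact ?K" "?K \<subseteq> S" using test_functionsD[OF v] by auto
  show "v x * inverse (e + v x) = 0" if "x \<notin> ?K" for x
    using test_function_eq_0(1)[OF v that] by simp
qed

lemma continuous_imp_measurable_lebesgue_on:
  assumes "continuous_on UNIV f"
  shows "f \<in> borel_measurable (lebesgue_on S)"
  using assms by (intro measurable_restrict_space1 measurable_completion) (simp add: borel_measurable_continuous_onI)

lemma integrable_bounded_scaleR:
  fixes f :: "'a::euclidean_space \<Rightarrow> real" and g :: "'a \<Rightarrow> 'b::euclidean_space"
  assumes f: "f \<in> borel_measurable M" and "\<forall>x. \<bar>f x\<bar> \<le> B" and g: "integrable M g"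
  shows "integrable M (\<lambda>x. f x *\<^sub>R g x)"
proof (rule Bochner_Integration.integrable_bound)
  show "integrable M (\<lambda>x. B *\<^sub>R g x)" using g by simp
  have "norm (f x *\<^sub>R g x) \<le> norm (B *\<^sub>R g x)" for x
    using assms(2)[rule_format, of x] by (auto intro!: mult_right_mono)
  then show "AE x in M. norm (f x *\<^sub>R g x) \<le> norm (B *\<^sub>R g x)" by simp
  show "(\<lambda>x. f x *\<^sub>R g x) \<in> borel_measurable M" using f g by measurable
qed

section \<open>Integrable functions orthogonal to every test function\<close>

context
  fixes S :: "'a::euclidean_space set" and g :: "'a \<Rightarrow> real"
  assumes S: "open S" and g: "integrable (lebesgue_on S) g"
    and orth: "\<And>v G. (v, G) \<in> test_functions S \<Longrightarrow> (LINT x|lebesgue_on S. v x * g x) = 0"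
begin

text \<open>Dominated convergence along the saturations of \<open>v\<close>, each of which
  integrates to 0 against \<open>g\<close>, with |g| as majorant.\<close>

lemma integral_over_bump_support:
  assumes v: "(v, G) \<in> test_functions S" and nonneg: "\<And>x. 0 \<le> v x"
  shows "(LINT x|lebesgue_on S. indicat_real {x. v x \<noteq> 0} x * g x) = 0"
proof -
  \<comment> \<open>The saturation parameter is 1 / (n + 1), positive and tending to 0.\<close>
  let ?s = "\<lambda>n x. v x * inverse (inverse (real (Suc n)) + v x)"
  have [measurable]: "v \<in> borel_measurable (lebesgue_on S)"
    by (rule continuous_imp_measurable_lebesgue_on[OF test_function_continuous[OF v]])
  have [measurable]: "g \<in> borel_measurable (lebesgue_on S)" using g by auto
  have "(\<lambda>n. LINT x|lebesgue_on S. ?s n x * g x) \<longlonglongrightarrow> (LINT x|lebesgue_on S. indicat_real {x. v x \<noteq> 0} x * g x)"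
  proof (rule integral_dominated_convergence[where w = "\<lambda>x. \<bar>g x\<bar>"])
    have "indicat_real {x. v x \<noteq> 0} = (\<lambda>x. if v x \<noteq> 0 then 1 else 0)" by (auto simp: fun_eq_iff)
    then have [measurable]: "indicat_real {x. v x \<noteq> 0} \<in> borel_measurable (lebesgue_on S)"
      by simp
    show "(\<lambda>x. indicat_real {x. v x \<noteq> 0} x * g x) \<in> borel_measurable (lebesgue_on S)" by measurable
    show "integrable (lebesgue_on S) (\<lambda>x. \<bar>g x\<bar>)" using g by simp
    show "(\<lambda>x. ?s n x * g x) \<in> borel_measurable (lebesgue_on S)" for n by measurable
    have "(\<lambda>n. ?s n x * g x) \<longlonglongrightarrow> indicat_real {x. v x \<noteq> 0} x * g x" for x
    proof (cases "v x = 0")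
      case False
      have "(\<lambda>n. ?s n x * g x) \<longlonglongrightarrow> v x * inverse (0 + v x) * g x"
        using False by (intro tendsto_intros LIMSEQ_inverse_real_of_nat) auto
      then show ?thesis using False by simp
    qed simp
    then show "AE x in lebesgue_on S. (\<lambda>n. ?s n x * g x) \<longlonglongrightarrow> indicat_real {x. v x \<noteq> 0} x * g x" by simp
    have "norm (?s n x * g x) \<le> \<bar>g x\<bar>" for n x
    proof -
      have "\<bar>t * inverse (e + t)\<bar> \<le> 1" if "0 < e" "0 \<le> t" for e t :: real
        using that by (simp add: abs_mult divide_simps)
      then have "\<bar>?s n x\<bar> \<le> 1" using nonneg[of x] by (simp del: of_nat_Suc)
      then show ?thesis by (simp add: abs_mult mult_left_le_one_le)
    qed
    then show "AE x in lebesgue_on S. norm (?s n x * g x) \<le> \<bar>g x\<bar>" for n by simp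
  qed
  moreover have "(LINT x|lebesgue_on S. ?s n x * g x) = 0" for n
    by (rule orth[OF test_function_saturate[OF v nonneg]]) simp
  ultimately show ?thesis by (simp add: LIMSEQ_const_iff)
qed

text \<open>By Lindelof the open set is a countable union of balls. Each finite union of them is the
  nonzero set of a sum of bumps, and dominated convergence passes to the whole union.\<close>

lemma integral_over_open:
  assumes A: "open A" "A \<subseteq> S"
  shows "(LINT x|lebesgue_on S. indicat_real A x * g x) = 0"
proof -
  \<comment> \<open>The closed balls have to lie in \<open>A\<close> as well, so that the bumps have
    compact support inside \<open>S\<close>.\<close>
  define F where "F = {C. \<exists>x r. C = ball x r \<and> 0 < r \<and> cball x r \<subseteq> A}"
  have "\<Union>F \<subseteq> A" unfolding F_def using ball_subset_cball by (intro Union_least) fast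
  moreover have "\<exists>C\<in>F. x \<in> C" if x: "x \<in> A" for x
  proof -
    obtain r where "0 < r" "cball x r \<subseteq> A" using open_contains_cball_eq[OF A(1)] x by auto
    then have "ball x r \<in> F" "x \<in> ball x r" unfolding F_def by auto
    then show ?thesis by (rule bexI[rotated])
  qed
  ultimately have F: "\<Union>F = A" by auto
  have "open C" if "C \<in> F" for C using that unfolding F_def by auto
  then obtain \<B> where B: "\<B> \<subseteq> F" "countable \<B>" "\<Union>\<B> = A"
    by (rule Lindelof[of F, unfolded F]) blast
  show ?thesis
  \<comment> \<open>Only a nonempty countable set is the range of the enumeration
    \<open>from_nat_into\<close>; repetitions in it are harmless.\<close>
  proof (cases "\<B> = {}")
    case True
    then show ?thesis using B by simp
  next
    case False
    let ?b = "from_nat_into \<B>"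
    let ?U = "\<lambda>n. \<Union>k<n. ?b k"
    have rb: "range ?b = \<B>" using False B(2) by simp
    have bump: "\<exists>v G. (v, G) \<in> test_functions S \<and> (\<forall>x. 0 \<le> v x) \<and> {x. v x \<noteq> 0} = ?U n" for n
    proof (induction n)
      case 0
      show ?case
        by (intro exI[of _ "\<lambda>x. 0"] conjI allI test_function_zero) simp_all
    next
      case (Suc n)
      then obtain v G where v: "(v, G) \<in> test_functions S" "\<And>x. 0 \<le> v x" "{x. v x \<noteq> 0} = ?U n" by auto
      have "?b n \<in> F" using rb B(1) by blast
      then obtain c r where cr: "?b n = ball c r" "0 < r" "cball c r \<subseteq> A" unfolding F_def by blast
      then have "cball c r \<subseteq> S" using A(2) by simp
      then obtain w H where w: "(w, H) \<in> test_functions S" "\<And>x. 0 \<le> w x" "{x. w x \<noteq> 0} = ?b n"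
        unfolding cr(1) using ball_bump[OF cr(2)] by blast
      \<comment> \<open>Nonnegativity excludes cancellation, so the nonzero sets unite.\<close>
      have "{x. v x + w x \<noteq> 0} = {x. v x \<noteq> 0} \<union> {x. w x \<noteq> 0}"
        using add_nonneg_eq_0_iff[OF v(2) w(2)] by blast
      also have "\<dots> = ?U (Suc n)" by (simp only: v(3) w(3) lessThan_Suc UN_insert Un_commute)
      finally show ?case
        by (intro exI[of _ "\<lambda>x. v x + w x"] exI[of _ "\<lambda>x. G x + H x"] conjI allI
            test_function_add[OF v(1) w(1)] add_nonneg_nonneg[OF v(2) w(2)])
    qed
    have [measurable]: "g \<in> borel_measurable (lebesgue_on S)" using g by auto
    have meas: "indicat_real C \<in> borel_measurable (lebesgue_on S)" if "open C" for C
      using that by (intro measurable_restrict_space1 measurable_completion borel_measurable_indicator) simp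
    have op: "open (?b k)" for k using rb B(1) by (metis \<open>\<And>C. C \<in> F \<Longrightarrow> open C\<close> rangeI subsetD)
    note [measurable] = meas[OF A(1)]
    have [measurable]: "indicat_real (?U n) \<in> borel_measurable (lebesgue_on S)" for n
      by (intro meas open_UN ballI op)
    have "(\<lambda>n. LINT x|lebesgue_on S. indicat_real (?U n) x * g x) \<longlonglongrightarrow> (LINT x|lebesgue_on S. indicat_real A x * g x)"
    proof (rule integral_dominated_convergence[where w = "\<lambda>x. \<bar>g x\<bar>"])
      show "(\<lambda>x. indicat_real A x * g x) \<in> borel_measurable (lebesgue_on S)" by measurable
      show "integrable (lebesgue_on S) (\<lambda>x. \<bar>g x\<bar>)" using g by simp
      show "(\<lambda>x. indicat_real (?U n) x * g x) \<in> borel_measurable (lebesgue_on S)" for n by measurable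
      have "(\<lambda>n. indicat_real (?U n) x) \<longlonglongrightarrow> indicat_real A x" for x
      proof -
        have "(\<Union>n. ?U n) = \<Union>(range ?b)" by blast
        then have "A = (\<Union>n. ?U n)" unfolding rb B(3) by (rule sym)
        moreover have "incseq ?U" by (intro incseq_SucI UN_mono) auto
        ultimately show ?thesis
          using LIMSEQ_indicator_incseq[of ?U x] by simp
      qed
      then show "AE x in lebesgue_on S. (\<lambda>n. indicat_real (?U n) x * g x) \<longlonglongrightarrow> indicat_real A x * g x"
        by (intro AE_I2 tendsto_mult_right)
      show "AE x in lebesgue_on S. norm (indicat_real (?U n) x * g x) \<le> \<bar>g x\<bar>" for n
        by (rule AE_I2) (simp add: indicator_def)
    qed
    moreover have "(LINT x|lebesgue_on S. indicat_real (?U n) x * g x) = 0" for n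
    proof -
      obtain v G where v: "(v, G) \<in> test_functions S" "\<forall>x. 0 \<le> v x" "{x. v x \<noteq> 0} = ?U n"
        using bump[of n] by blast
      show ?thesis
        using integral_over_bump_support[OF v(1)] v(2) unfolding v(3) by simp
    qed
    ultimately show ?thesis by (simp add: LIMSEQ_const_iff)
  qed
qed

text \<open>Up to a null set, \<open>?P\<close> is a countable union of compact sets. The integral
  of \<open>g\<close> over such a compact set is that over \<open>S\<close> minus that over an open
  remainder, hence 0; since \<open>g\<close> is positive there, the compact set is null.\<close>

lemma positive_part_null: "AE x in lebesgue_on S. g x \<le> 0"
proof -
  let ?P = "{x \<in> S. g x > 0}"
  have SL: "S \<in> sets lebesgue" using S by auto
  have [measurable]: "g \<in> borel_measurable (lebesgue_on S)" using g by auto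
  have "{x \<in> space (lebesgue_on S). g x > 0} \<in> sets (lebesgue_on S)" by measurable
  then have "?P \<in> sets lebesgue" using SL by (auto simp: sets_restrict_space_iff)
  then obtain C N where CN: "fsigma C" "N \<in> null_sets lebesgue" "C \<union> N = ?P"
    using lebesgue_set_almost_fsigma by metis
  obtain F :: "nat \<Rightarrow> 'a set" where F: "range F \<subseteq> Collect compact" "C = \<Union>(F ` UNIV)"
    using CN(1) fsigma_Union_compact by blast
  have "F n \<in> null_sets lebesgue" for n
  proof -
    let ?K = "F n"
    have K: "compact ?K" "?K \<subseteq> ?P" using F CN(3) by auto
    have KL: "?K \<in> sets lebesgue" using K(1) by (simp add: borel_compact)
    have KS: "?K \<in> sets (lebesgue_on S)" using KL K(2) SL by (auto simp: sets_restrict_space_iff)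
    have int: "integrable (lebesgue_on S) (\<lambda>x. indicat_real C x * g x)" if "C \<in> sets (lebesgue_on S)" for C
      using integrable_mult_indicator[OF that g] by simp
    have "(LINT x|lebesgue_on S. indicat_real S x * g x)
        = (LINT x|lebesgue_on S. indicat_real (S - ?K) x * g x + indicat_real ?K x * g x)"
      using K(2) by (intro Bochner_Integration.integral_cong) (auto simp: indicator_def)
    also have "\<dots> = (LINT x|lebesgue_on S. indicat_real (S - ?K) x * g x) + (LINT x|lebesgue_on S. indicat_real ?K x * g x)"
      by (intro Bochner_Integration.integral_add int KS) (use KS in auto)
    finally have "(LINT x|lebesgue_on S. indicat_real ?K x * g x) = 0"
      using integral_over_open[of S] integral_over_open[of "S - ?K"] S K(1)
      by (simp add: open_Diff compact_imp_closed)
    moreover have "AE x in lebesgue_on S. 0 \<le> indicat_real ?K x * g x"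
      by (rule AE_I2) (use K(2) in \<open>auto simp: indicator_def\<close>)
    ultimately have "AE x in lebesgue_on S. indicat_real ?K x * g x = 0"
      using integral_nonneg_eq_0_iff_AE[OF int[OF KS]] by simp
    then have "AE x in lebesgue_on S. x \<notin> ?K"
      by (rule AE_mp) (use K(2) in \<open>auto simp: indicator_def intro!: AE_I2\<close>)
    then have "AE x in lebesgue. x \<notin> ?K"
      using SL K(2) by (subst (asm) AE_restrict_space_iff) auto
    then show ?thesis using KL by (simp add: AE_iff_null_sets)
  qed
  then have "C \<union> N \<in> null_sets lebesgue" using CN(2) F(2) by (auto intro!: null_sets_UN)
  then have "AE x in lebesgue. x \<notin> ?P" unfolding CN(3) by (rule AE_not_in)
  then show ?thesis using SL by (subst AE_restrict_space_iff) (auto simp: not_less)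
qed

end

text \<open>The scalar result is applied to the components of \<open>g\<close> along b and -b, and
  the finite basis leaves a single exceptional null set.\<close>

theorem fundamental_lemma:
  fixes g :: "'a::euclidean_space \<Rightarrow> 'b::euclidean_space"
  assumes S: "open S" and g: "integrable (lebesgue_on S) g"
    and orth: "\<And>v G. (v, G) \<in> test_functions S \<Longrightarrow> (LINT x|lebesgue_on S. v x *\<^sub>R g x) = 0"
  shows "AE x in lebesgue_on S. g x = 0"
proof -
  have "AE x in lebesgue_on S. g x \<bullet> b \<le> 0" for b
  proof (rule positive_part_null[OF S])
    show "integrable (lebesgue_on S) (\<lambda>x. g x \<bullet> b)" using g by simp
    fix v G assume v: "(v, G) \<in> test_functions S"
    obtain B where "\<forall>x. \<bar>v x\<bar> \<le> B" using test_function_bounded[OF v] by blast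
    then have "integrable (lebesgue_on S) (\<lambda>x. v x *\<^sub>R g x)"
      using continuous_imp_measurable_lebesgue_on[OF test_function_continuous[OF v]] g
      by (intro integrable_bounded_scaleR)
    from integral_inner_left[OF this, of b]
    show "(LINT x|lebesgue_on S. v x * (g x \<bullet> b)) = 0" by (simp add: orth[OF v])
  qed
  then have "AE x in lebesgue_on S. g x \<bullet> b \<le> 0 \<and> g x \<bullet> (-b) \<le> 0" for b
    using AE_conjI by blast
  then have "AE x in lebesgue_on S. \<forall>b\<in>Basis. g x \<bullet> b \<le> 0 \<and> g x \<bullet> (-b) \<le> 0"
    by (intro AE_finite_allI finite_Basis)
  then show ?thesis
  proof (rule AE_mp, intro AE_I2 impI)
    fix x assume "\<forall>b\<in>Basis. g x \<bullet> b \<le> 0 \<and> g x \<bullet> (-b) \<le> 0"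
    then have "g x \<bullet> b = 0 \<bullet> b" if "b \<in> Basis" for b
      using that by (simp add: order_antisym)
    then show "g x = 0" by (rule euclidean_eqI)
  qed
qed

section \<open>Weak gradients and the broken energy\<close>

lemma L2_measurable: "f \<in> L2 S \<Longrightarrow> f \<in> borel_measurable (lebesgue_on S)"
  by (simp add: L2_def)

lemma L2_lincomb:
  fixes f g :: "'a::euclidean_space \<Rightarrow> 'b::euclidean_space"
  assumes "f \<in> L2 S" "g \<in> L2 S"
  shows "(\<lambda>x. a *\<^sub>R f x + b *\<^sub>R g x) \<in> L2 S"
proof -
  note [measurable] = assms[THEN L2_measurable]
  have bound: "(norm (a *\<^sub>R y + b *\<^sub>R z))\<^sup>2 \<le> 2 * a\<^sup>2 * (norm y)\<^sup>2 + 2 * b\<^sup>2 * (norm z)\<^sup>2" for y z :: 'b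
  proof -
    have "(norm (a *\<^sub>R y + b *\<^sub>R z))\<^sup>2 \<le> (\<bar>a\<bar> * norm y + \<bar>b\<bar> * norm z)\<^sup>2"
      by (intro power_mono) (use norm_triangle_ineq[of "a *\<^sub>R y" "b *\<^sub>R z"] in auto)
    also have "\<dots> \<le> 2 * (\<bar>a\<bar> * norm y)\<^sup>2 + 2 * (\<bar>b\<bar> * norm z)\<^sup>2"
      using sum_squares_bound[of "\<bar>a\<bar> * norm y" "\<bar>b\<bar> * norm z"] by (simp add: power2_sum)
    finally show ?thesis by (simp add: power_mult_distrib mult.assoc)
  qed
  have "integrable (lebesgue_on S) (\<lambda>x. (norm (a *\<^sub>R f x + b *\<^sub>R g x))\<^sup>2)"
  proof (rule Bochner_Integration.integrable_bound)
    show "integrable (lebesgue_on S) (\<lambda>x. 2 * a\<^sup>2 * (norm (f x))\<^sup>2 + 2 * b\<^sup>2 * (norm (g x))\<^sup>2)"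
      using assms by (simp add: L2_def)
    show "(\<lambda>x. (norm (a *\<^sub>R f x + b *\<^sub>R g x))\<^sup>2) \<in> borel_measurable (lebesgue_on S)" by measurable
    show "AE x in lebesgue_on S. norm ((norm (a *\<^sub>R f x + b *\<^sub>R g x))\<^sup>2)
        \<le> norm (2 * a\<^sup>2 * (norm (f x))\<^sup>2 + 2 * b\<^sup>2 * (norm (g x))\<^sup>2)"
    proof (rule AE_I2)
      fix x
      show "norm ((norm (a *\<^sub>R f x + b *\<^sub>R g x))\<^sup>2) \<le> norm (2 * a\<^sup>2 * (norm (f x))\<^sup>2 + 2 * b\<^sup>2 * (norm (g x))\<^sup>2)"
        using bound[of "f x" "g x"] by simp
    qed
  qed
  then show ?thesis unfolding L2_def by simp
qed

lemma L2_inner_integrable: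
  fixes f g :: "'a::euclidean_space \<Rightarrow> 'b::euclidean_space"
  assumes "f \<in> L2 S" "g \<in> L2 S"
  shows "integrable (lebesgue_on S) (\<lambda>x. f x \<bullet> g x)"
proof (rule Bochner_Integration.integrable_bound)
  note [measurable] = assms[THEN L2_measurable]
  show "integrable (lebesgue_on S) (\<lambda>x. (norm (f x))\<^sup>2 + (norm (g x))\<^sup>2)"
    using assms by (simp add: L2_def)
  show "(\<lambda>x. f x \<bullet> g x) \<in> borel_measurable (lebesgue_on S)" by measurable
  have "\<bar>y \<bullet> z\<bar> \<le> (norm y)\<^sup>2 + (norm z)\<^sup>2" for y z :: 'b
  proof -
    have "0 \<le> norm y * norm z" by simp
    then show ?thesis
      using Cauchy_Schwarz_ineq2[of y z] sum_squares_bound[of "norm y" "norm z"] by linarith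
  qed
  then show "AE x in lebesgue_on S. norm (f x \<bullet> g x) \<le> norm ((norm (f x))\<^sup>2 + (norm (g x))\<^sup>2)"
    by simp
qed

text \<open>Finite measure and t \<le> 1 + t^2 give integrability, the form in which bounded test
  functions and the fundamental lemma can be applied.\<close>

lemma L2_integrable:
  fixes f :: "'a::euclidean_space \<Rightarrow> 'b::euclidean_space"
  assumes S: "S \<in> lmeasurable" and f: "f \<in> L2 S"
  shows "integrable (lebesgue_on S) f"
proof (rule Bochner_Integration.integrable_bound)
  interpret finite_measure "lebesgue_on S" by (rule finite_measure_lebesgue_on[OF S])
  show "integrable (lebesgue_on S) (\<lambda>x. 1 + (norm (f x))\<^sup>2)"
    using f by (simp add: L2_def)
  show "f \<in> borel_measurable (lebesgue_on S)" by (rule L2_measurable[OF f])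
  have "t \<le> 1 + t\<^sup>2" if "0 \<le> t" for t :: real
    using sum_squares_bound[of 1 t] that by simp
  then show "AE x in lebesgue_on S. norm (f x) \<le> norm (1 + (norm (f x))\<^sup>2)" by simp
qed

lemma L2_inner_lincomb:
  assumes "f \<in> L2 S" "g \<in> L2 S" "h \<in> L2 S"
  shows "L2_inner S (\<lambda>x. a * f x + b * g x) h = a * L2_inner S f h + b * L2_inner S g h"
  using L2_inner_integrable[OF assms(1,3)] L2_inner_integrable[OF assms(2,3)]
  by (simp add: L2_inner_def algebra_simps)

lemma L2_inner_cong_AE:
  assumes "f \<in> L2 S" "g \<in> L2 S" "h \<in> L2 S" and "AE x in lebesgue_on S. f x = g x"
  shows "L2_inner S f h = L2_inner S g h"
proof -
  note [measurable] = assms(1-3)[THEN L2_measurable]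
  show ?thesis
    unfolding L2_inner_def by (rule integral_cong_AE) (use assms(4) in auto)
qed

lemma L2_inner_commute: "L2_inner S f g = L2_inner S g f"
  by (simp add: L2_inner_def mult.commute)

lemma L2_inner_self_nonneg: "0 \<le> L2_inner S f f"
  by (simp add: L2_inner_def)

lemma test_function_integrable:
  fixes g :: "'a::euclidean_space \<Rightarrow> 'b::euclidean_space"
  assumes v: "(v, G) \<in> test_functions S"
  shows "integrable (lebesgue_on S) g \<Longrightarrow> integrable (lebesgue_on S) (\<lambda>x. v x *\<^sub>R g x)"
    and "integrable (lebesgue_on S) f \<Longrightarrow> integrable (lebesgue_on S) (\<lambda>x. f x *\<^sub>R G x)"
proof -
  obtain B where "\<forall>x. \<bar>v x\<bar> \<le> B" using test_function_bounded[OF v] by blast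
  then show "integrable (lebesgue_on S) g \<Longrightarrow> integrable (lebesgue_on S) (\<lambda>x. v x *\<^sub>R g x)"
    using continuous_imp_measurable_lebesgue_on[OF test_function_continuous[OF v]]
    by (intro integrable_bounded_scaleR)
next
  assume f: "integrable (lebesgue_on S) f"
  obtain B where B: "\<forall>x. norm (G x) \<le> B" using test_function_bounded[OF v] by blast
  have [measurable]: "G \<in> borel_measurable (lebesgue_on S)"
    using continuous_imp_measurable_lebesgue_on[OF test_functionsD(2)[OF v]] .
  have [measurable]: "f \<in> borel_measurable (lebesgue_on S)" using f by auto
  show "integrable (lebesgue_on S) (\<lambda>x. f x *\<^sub>R G x)"
  proof (rule Bochner_Integration.integrable_bound)
    show "integrable (lebesgue_on S) (\<lambda>x. B * f x)" using f by simp
    show "(\<lambda>x. f x *\<^sub>R G x) \<in> borel_measurable (lebesgue_on S)" by measurable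
    have "norm (f x *\<^sub>R G x) \<le> norm (B * f x)" for x
    proof -
      have "\<bar>f x\<bar> * norm (G x) \<le> \<bar>f x\<bar> * \<bar>B\<bar>"
        using B[rule_format, of x] by (intro mult_left_mono) auto
      then show ?thesis by (simp add: abs_mult mult.commute)
    qed
    then show "AE x in lebesgue_on S. norm (f x *\<^sub>R G x) \<le> norm (B * f x)" by simp
  qed
qed

section \<open>Weak gradients: linearity and uniqueness almost everywhere\<close>

lemma is_weak_gradD:
  assumes "is_weak_grad S f g" "(v, G) \<in> test_functions S"
  shows "(LINT x|lebesgue_on S. f x *\<^sub>R G x) = - (LINT x|lebesgue_on S. v x *\<^sub>R g x)"
  using assms unfolding is_weak_grad_def by blast

lemma is_weak_grad_lincomb:
  assumes S: "S \<in> lmeasurable" and L2: "f \<in> L2 S" "g \<in> L2 S" "F \<in> L2 S" "H \<in> L2 S"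
    and weak: "is_weak_grad S f F" "is_weak_grad S g H"
  shows "is_weak_grad S (\<lambda>x. a * f x + b * g x) (\<lambda>x. a *\<^sub>R F x + b *\<^sub>R H x)"
  unfolding is_weak_grad_def
proof safe
  fix v G assume v: "(v, G) \<in> test_functions S"
  note int = L2[THEN L2_integrable[OF S]]
  have "(LINT x|lebesgue_on S. (a * f x + b * g x) *\<^sub>R G x)
      = (LINT x|lebesgue_on S. a *\<^sub>R (f x *\<^sub>R G x) + b *\<^sub>R (g x *\<^sub>R G x))"
    by (simp add: scaleR_add_left)
  also have "\<dots> = a *\<^sub>R (LINT x|lebesgue_on S. f x *\<^sub>R G x) + b *\<^sub>R (LINT x|lebesgue_on S. g x *\<^sub>R G x)"
    using test_function_integrable(2)[OF v int(1)] test_function_integrable(2)[OF v int(2)]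
    by (simp del: scaleR_scaleR)
  also have "\<dots> = a *\<^sub>R - (LINT x|lebesgue_on S. v x *\<^sub>R F x) + b *\<^sub>R - (LINT x|lebesgue_on S. v x *\<^sub>R H x)"
    by (simp only: weak[THEN is_weak_gradD, OF v])
  also have "\<dots> = - (LINT x|lebesgue_on S. a *\<^sub>R (v x *\<^sub>R F x) + b *\<^sub>R (v x *\<^sub>R H x))"
    using test_function_integrable(1)[OF v int(3)] test_function_integrable(1)[OF v int(4)]
    by (simp del: scaleR_scaleR)
  finally show "(LINT x|lebesgue_on S. (a * f x + b * g x) *\<^sub>R G x)
      = - (LINT x|lebesgue_on S. v x *\<^sub>R (a *\<^sub>R F x + b *\<^sub>R H x))"
    by (simp add: scaleR_add_right mult.commute)
qed

text \<open>The difference of two weak gradients integrates to 0 against every test function, so the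
  fundamental lemma applies. Hence the choice made by \<open>SOME\<close> matters only on null
  sets.\<close>

lemma weak_grad_unique:
  assumes S: "open S" "S \<in> lmeasurable" and L2: "F \<in> L2 S" "H \<in> L2 S"
    and weak: "is_weak_grad S f F" "is_weak_grad S f H"
  shows "AE x in lebesgue_on S. F x = H x"
proof -
  note int = L2[THEN L2_integrable[OF S(2)]]
  have "AE x in lebesgue_on S. F x - H x = 0"
  proof (rule fundamental_lemma[OF S(1)])
    show "integrable (lebesgue_on S) (\<lambda>x. F x - H x)" using int by simp
    fix v G assume v: "(v, G) \<in> test_functions S"
    have "(LINT x|lebesgue_on S. v x *\<^sub>R F x) = (LINT x|lebesgue_on S. v x *\<^sub>R H x)"
      using is_weak_gradD[OF weak(1) v] is_weak_gradD[OF weak(2) v] by simp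
    then show "(LINT x|lebesgue_on S. v x *\<^sub>R (F x - H x)) = 0"
      using test_function_integrable(1)[OF v int(1)] test_function_integrable(1)[OF v int(2)]
      by (simp add: scaleR_diff_right)
  qed
  then show ?thesis by simp
qed

lemma weak_grad:
  assumes "f \<in> H1 S"
  shows "weak_grad S f \<in> L2 S" "is_weak_grad S f (weak_grad S f)"
proof -
  have "\<exists>g. g \<in> L2 S \<and> is_weak_grad S f g" using assms unfolding H1_def by auto
  from someI_ex[OF this] show "weak_grad S f \<in> L2 S" "is_weak_grad S f (weak_grad S f)"
    unfolding weak_grad_def by auto
qed

lemma H1_L2: "f \<in> H1 S \<Longrightarrow> f \<in> L2 S"
  by (simp add: H1_def)

lemma H1_lincomb:
  assumes S: "S \<in> lmeasurable" and H1: "f \<in> H1 S" "g \<in> H1 S"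
  shows "(\<lambda>x. a * f x + b * g x) \<in> H1 S"
proof -
  have "(\<lambda>x. a * f x + b * g x) \<in> L2 S"
    using L2_lincomb[OF H1[THEN H1_L2], of a b] by simp
  moreover have "is_weak_grad S (\<lambda>x. a * f x + b * g x) (\<lambda>x. a *\<^sub>R weak_grad S f x + b *\<^sub>R weak_grad S g x)"
    by (intro is_weak_grad_lincomb S H1_L2 weak_grad H1)
  moreover have "(\<lambda>x. a *\<^sub>R weak_grad S f x + b *\<^sub>R weak_grad S g x) \<in> L2 S"
    by (intro L2_lincomb weak_grad H1)
  ultimately show ?thesis unfolding H1_def by blast
qed

text \<open>Both sides are square integrable weak gradients of the same combination. Equality is
  only almost everywhere because \<open>SOME\<close> chooses the three gradients
  independently.\<close>

lemma weak_grad_lincomb: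
  assumes S: "open S" "S \<in> lmeasurable" and H1: "f \<in> H1 S" "g \<in> H1 S"
  shows "AE x in lebesgue_on S.
    weak_grad S (\<lambda>x. a * f x + b * g x) x = a *\<^sub>R weak_grad S f x + b *\<^sub>R weak_grad S g x"
  by (rule weak_grad_unique[OF S, where f = "\<lambda>x. a * f x + b * g x"])
    (intro is_weak_grad_lincomb L2_lincomb weak_grad H1_lincomb H1_L2 S H1)+

text \<open>The predicate under \<open>SOME\<close> sees \<open>f\<close> only through integrals, so
  it is literally the same for \<open>g\<close>, and the two choices agree at every point.\<close>

lemma weak_grad_cong_AE:
  assumes L2: "f \<in> L2 S" "g \<in> L2 S" and eq: "AE x in lebesgue_on S. f x = g x"
  shows "weak_grad S f = weak_grad S g"
proof -
  have "is_weak_grad S f = is_weak_grad S g"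
  proof -
    have "(LINT x|lebesgue_on S. f x *\<^sub>R G x) = (LINT x|lebesgue_on S. g x *\<^sub>R G x)"
      if v: "(v, G) \<in> test_functions S" for v G
    proof -
      note [measurable] = L2[THEN L2_measurable]
        continuous_imp_measurable_lebesgue_on[OF test_functionsD(2)[OF v], of S]
      show ?thesis by (rule integral_cong_AE) (use eq in auto)
    qed
    then show ?thesis unfolding is_weak_grad_def fun_eq_iff by (metis (mono_tags, lifting) case_prodI2 case_prodD)
  qed
  then show ?thesis unfolding weak_grad_def by simp
qed

section \<open>The broken energy as a symmetric nonnegative bilinear form\<close>

locale broken_coefficient =
  fixes \<kappa> :: "'a::euclidean_space \<Rightarrow> real" and \<M> :: "'a set set" and B :: real
  assumes block_lmeasurable: "K \<in> \<M> \<Longrightarrow> interior K \<in> lmeasurable"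
    and coefficient_measurable: "K \<in> \<M> \<Longrightarrow> \<kappa> \<in> borel_measurable (lebesgue_on (interior K))"
    and coefficient_bounds: "K \<in> \<M> \<Longrightarrow> x \<in> interior K \<Longrightarrow> 0 \<le> \<kappa> x \<and> \<kappa> x \<le> B"
begin

lemma broken_H1_lincomb:
  assumes "f \<in> broken_H1 \<M>" "g \<in> broken_H1 \<M>"
  shows "(\<lambda>x. a * f x + b * g x) \<in> broken_H1 \<M>"
  using assms H1_lincomb block_lmeasurable unfolding broken_H1_def by blast

lemma energy_integrable:
  assumes K: "K \<in> \<M>" and "F \<in> L2 (interior K)" "G \<in> L2 (interior K)"
  shows "integrable (lebesgue_on (interior K)) (\<lambda>x. \<kappa> x * (F x \<bullet> G x))"
proof (rule Bochner_Integration.integrable_bound)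
  note [measurable] = coefficient_measurable[OF K] assms(2,3)[THEN L2_measurable]
  show "integrable (lebesgue_on (interior K)) (\<lambda>x. B * (F x \<bullet> G x))"
    using L2_inner_integrable[OF assms(2,3)] by simp
  show "(\<lambda>x. \<kappa> x * (F x \<bullet> G x)) \<in> borel_measurable (lebesgue_on (interior K))" by measurable
  show "AE x in lebesgue_on (interior K). norm (\<kappa> x * (F x \<bullet> G x)) \<le> norm (B * (F x \<bullet> G x))"
  proof (rule AE_I2)
    fix x assume "x \<in> space (lebesgue_on (interior K))"
    then have "\<bar>\<kappa> x\<bar> \<le> \<bar>B\<bar>" using coefficient_bounds[OF K, of x] by simp
    then show "norm (\<kappa> x * (F x \<bullet> G x)) \<le> norm (B * (F x \<bullet> G x))"
      by (simp add: abs_mult mult_right_mono)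
  qed
qed

text \<open>On each block the gradient of the combination may be replaced under the integral by the
  combination of gradients; boundedness of the coefficient then allows the integral to be
  split.\<close>

lemma broken_energy_lincomb:
  assumes "f \<in> broken_H1 \<M>" "g \<in> broken_H1 \<M>" "h \<in> broken_H1 \<M>"
  shows "broken_energy \<kappa> \<M> (\<lambda>x. a * f x + b * g x) h = a * broken_energy \<kappa> \<M> f h + b * broken_energy \<kappa> \<M> g h"
proof -
  have "(LINT x|lebesgue_on (interior K).
        \<kappa> x * (weak_grad (interior K) (\<lambda>x. a * f x + b * g x) x \<bullet> weak_grad (interior K) h x))
      = a * (LINT x|lebesgue_on (interior K). \<kappa> x * (weak_grad (interior K) f x \<bullet> weak_grad (interior K) h x))
        + b * (LINT x|lebesgue_on (interior K). \<kappa> x * (weak_grad (interior K) g x \<bullet> weak_grad (interior K) h x))"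
    (is "?l = ?r") if K: "K \<in> \<M>" for K
  proof -
    let ?I = "interior K"
    have H1: "f \<in> H1 ?I" "g \<in> H1 ?I" "h \<in> H1 ?I" "(\<lambda>x. a * f x + b * g x) \<in> H1 ?I"
      using assms broken_H1_lincomb[OF assms(1,2)] K unfolding broken_H1_def by auto
    note L2 = H1[THEN weak_grad(1)]
    note [measurable] = coefficient_measurable[OF K] L2[THEN L2_measurable]
    have "?l = (LINT x|lebesgue_on ?I. \<kappa> x * ((a *\<^sub>R weak_grad ?I f x + b *\<^sub>R weak_grad ?I g x) \<bullet> weak_grad ?I h x))"
    proof (rule integral_cong_AE)
      show "AE x in lebesgue_on ?I. \<kappa> x * (weak_grad ?I (\<lambda>x. a * f x + b * g x) x \<bullet> weak_grad ?I h x)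
          = \<kappa> x * ((a *\<^sub>R weak_grad ?I f x + b *\<^sub>R weak_grad ?I g x) \<bullet> weak_grad ?I h x)"
        using weak_grad_lincomb[OF open_interior block_lmeasurable[OF K] H1(1,2), of a b]
        by eventually_elim simp
    qed measurable
    also have "\<dots> = (LINT x|lebesgue_on ?I. a * (\<kappa> x * (weak_grad ?I f x \<bullet> weak_grad ?I h x))
        + b * (\<kappa> x * (weak_grad ?I g x \<bullet> weak_grad ?I h x)))"
      by (simp add: inner_add_left algebra_simps)
    also have "\<dots> = ?r"
      using energy_integrable[OF K L2(1,3)] energy_integrable[OF K L2(2,3)] by simp
    finally show ?thesis .
  qed
  then show ?thesis
    unfolding broken_energy_def by (simp add: sum.distrib sum_distrib_left)
qed

lemma broken_energy_self_nonneg: "0 \<le> broken_energy \<kappa> \<M> f f"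
  unfolding broken_energy_def
  by (intro sum_nonneg integral_nonneg_AE AE_I2 mult_nonneg_nonneg)
    (auto dest: coefficient_bounds)

end

lemma broken_energy_commute: "broken_energy \<kappa> \<M> f g = broken_energy \<kappa> \<M> g f"
  by (simp add: broken_energy_def inner_commute)

lemma broken_energy_cong_AE:
  assumes "f \<in> broken_H1 \<M>" "g \<in> broken_H1 \<M>"
    and "\<And>K. K \<in> \<M> \<Longrightarrow> AE x in lebesgue_on (interior K). f x = g x"
  shows "broken_energy \<kappa> \<M> f h = broken_energy \<kappa> \<M> g h"
proof -
  have "weak_grad (interior K) f = weak_grad (interior K) g" if "K \<in> \<M>" for K
    using assms that by (intro weak_grad_cong_AE H1_L2) (auto simp: broken_H1_def)
  then show ?thesis by (simp add: broken_energy_def)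
qed

section \<open>Coupled forms\<close>

declare One_nat_def [simp del]

text \<open>The forms m, a and c share this structure, which makes the energy estimate pure algebra.
  In \<open>F i j u w\<close> the first argument belongs to \<open>V j\<close> and the second to
  \<open>V i\<close>. Positivity is that of the full 2 x 2 block form on pairs; setting one entry to
  0 yields it for the diagonal forms.\<close>

locale coupled_form =
  fixes V :: "nat \<Rightarrow> 'v::real_vector set" and F :: "nat \<Rightarrow> nat \<Rightarrow> 'v \<Rightarrow> 'v \<Rightarrow> real"
  assumes subspace_V: "j \<in> {1, 2} \<Longrightarrow> subspace (V j)"
    and lincomb_left: "i \<in> {1, 2} \<Longrightarrow> j \<in> {1, 2} \<Longrightarrow> u \<in> V j \<Longrightarrow> v \<in> V j \<Longrightarrow> w \<in> V i \<Longrightarrow>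
      F i j (a *\<^sub>R u + b *\<^sub>R v) w = a * F i j u w + b * F i j v w"
    and sym: "F i j u w = F j i w u"
    and pair_nonneg: "u \<in> V 1 \<Longrightarrow> w \<in> V 2 \<Longrightarrow> 0 \<le> F 1 1 u u + 2 * F 2 1 u w + F 2 2 w w"
begin

lemma lincomb_right:
  "i \<in> {1, 2} \<Longrightarrow> j \<in> {1, 2} \<Longrightarrow> u \<in> V i \<Longrightarrow> v \<in> V i \<Longrightarrow> w \<in> V j \<Longrightarrow>
    F i j w (a *\<^sub>R u + b *\<^sub>R v) = a * F i j w u + b * F i j w v"
  using lincomb_left[of j i u v w a b] by (simp add: sym[of i j])

lemma diff_left: "i \<in> {1, 2} \<Longrightarrow> j \<in> {1, 2} \<Longrightarrow> u \<in> V j \<Longrightarrow> v \<in> V j \<Longrightarrow> w \<in> V i \<Longrightarrow>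
    F i j (u - v) w = F i j u w - F i j v w"
  using lincomb_left[of i j u v w 1 "-1"] by simp

lemma diff_right: "i \<in> {1, 2} \<Longrightarrow> j \<in> {1, 2} \<Longrightarrow> u \<in> V i \<Longrightarrow> v \<in> V i \<Longrightarrow> w \<in> V j \<Longrightarrow>
    F i j w (u - v) = F i j w u - F i j w v"
  using lincomb_right[of i j u v w 1 "-1"] by simp

lemma scale_left: "i \<in> {1, 2} \<Longrightarrow> j \<in> {1, 2} \<Longrightarrow> u \<in> V j \<Longrightarrow> w \<in> V i \<Longrightarrow>
    F i j (a *\<^sub>R u) w = a * F i j u w"
  using lincomb_left[of i j u u w a 0] by simp

lemma zero_mem: "j \<in> {1, 2} \<Longrightarrow> 0 \<in> V j"
  using subspace_V subspace_0 by blast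

lemma zero_left: "i \<in> {1, 2} \<Longrightarrow> j \<in> {1, 2} \<Longrightarrow> w \<in> V i \<Longrightarrow> F i j 0 w = 0"
  using scale_left[of i j 0 w 0] zero_mem by simp

lemma diag_nonneg: "i \<in> {1, 2} \<Longrightarrow> u \<in> V i \<Longrightarrow> 0 \<le> F i i u u"
  using pair_nonneg[of u 0] pair_nonneg[of 0 u] zero_mem zero_left sym[of 2 1 u 0] by auto

text \<open>The forms may be degenerate, so the inequality is read off from the quadratic form in
  (s, t), evaluated at suitable points.\<close>

lemma Cauchy_Schwarz:
  assumes u: "u \<in> V 1" and w: "w \<in> V 2"
  shows "(F 2 1 u w)\<^sup>2 \<le> F 1 1 u u * F 2 2 w w"
proof -
  let ?a = "F 1 1 u u" and ?b = "F 2 1 u w" and ?c = "F 2 2 w w"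
  have mem: "s *\<^sub>R u \<in> V 1" "t *\<^sub>R w \<in> V 2" for s t
    using subspace_V u w by (simp_all add: subspace_scale)
  have quad: "0 \<le> s\<^sup>2 * ?a + 2 * s * t * ?b + t\<^sup>2 * ?c" for s t
  proof -
    have "F 1 1 (s *\<^sub>R u) (s *\<^sub>R u) = s * (s * ?a)"
      using u mem by (subst scale_left, simp_all) (subst sym, subst scale_left, simp_all)
    moreover have "F 2 1 (s *\<^sub>R u) (t *\<^sub>R w) = s * (t * ?b)"
      using u w mem by (subst scale_left, simp_all) (subst sym, subst scale_left, simp_all add: sym[of 1 2])
    moreover have "F 2 2 (t *\<^sub>R w) (t *\<^sub>R w) = t * (t * ?c)"
      using w mem by (subst scale_left, simp_all) (subst sym, subst scale_left, simp_all)
    ultimately show ?thesis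
      using pair_nonneg[OF mem, of s t] by (simp add: power2_eq_square algebra_simps)
  qed
  have a: "0 \<le> ?a" and c: "0 \<le> ?c" using diag_nonneg u w by auto
  show ?thesis
  proof (cases "?a = 0")
    case False
    \<comment> \<open>The point s = b, t = -a yields a (a c - b^2) \<ge> 0, and a > 0 can be
      cancelled.\<close>
    have "0 \<le> ?b\<^sup>2 * ?a + 2 * ?b * (- ?a) * ?b + (- ?a)\<^sup>2 * ?c" by (rule quad)
    also have "\<dots> = ?a * (?a * ?c - ?b\<^sup>2)" by (simp add: power2_eq_square algebra_simps)
    finally show ?thesis using a False by (simp add: zero_le_mult_iff)
  next
    case True
    \<comment> \<open>For a = 0 the point s = -(c + 1) b, t = 1 gives 2 b^2 \<le> c. If b were
      nonzero, c would be positive, while s = -c / b, t = 1 gives c \<le> 0.\<close>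
    have "0 \<le> (- (?c + 1) * ?b)\<^sup>2 * ?a + 2 * (- (?c + 1) * ?b) * 1 * ?b + 1\<^sup>2 * ?c" by (rule quad)
    then have "2 * (?c + 1) * ?b\<^sup>2 \<le> ?c" using True by (simp add: power2_eq_square algebra_simps)
    moreover have "0 \<le> ?c * ?b\<^sup>2" using c by simp
    ultimately have small: "2 * ?b\<^sup>2 \<le> ?c" by (simp add: algebra_simps)
    have "?b = 0"
    proof (rule ccontr)
      assume "?b \<noteq> 0"
      then have "0 < ?b\<^sup>2" by simp
      have "0 \<le> (- (?c / ?b))\<^sup>2 * ?a + 2 * (- (?c / ?b)) * 1 * ?b + 1\<^sup>2 * ?c" by (rule quad)
      then have "?c \<le> 0" using True \<open>?b \<noteq> 0\<close> by simp
      then show False using small \<open>0 < ?b\<^sup>2\<close> by simp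
    qed
    then show ?thesis using True by simp
  qed
qed

end

text \<open>
  Since the weak gradient is linear only almost everywhere, so is the downscaling map; hence
  \<open>L\<close> is linear only as far as \<open>B\<close> can see.
\<close>

lemma coupled_formI:
  fixes B :: "('a \<Rightarrow> real) \<Rightarrow> ('a \<Rightarrow> real) \<Rightarrow> real" and L :: "nat \<Rightarrow> 'v::real_vector \<Rightarrow> 'a \<Rightarrow> real"
  assumes V: "\<And>j. j \<in> {1, 2} \<Longrightarrow> subspace (V j)"
    and X: "\<And>f g a b. f \<in> X \<Longrightarrow> g \<in> X \<Longrightarrow> (\<lambda>x. a * f x + b * g x) \<in> X"
    and B_lincomb: "\<And>f g h a b. f \<in> X \<Longrightarrow> g \<in> X \<Longrightarrow> h \<in> X \<Longrightarrow>
      B (\<lambda>x. a * f x + b * g x) h = a * B f h + b * B g h"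
    and B_commute: "\<And>f g. B f g = B g f"
    and B_nonneg: "\<And>f. 0 \<le> B f f"
    and L_mem: "\<And>j u. j \<in> {1, 2} \<Longrightarrow> u \<in> V j \<Longrightarrow> L j u \<in> X"
    and L_lincomb: "\<And>j u v h a b. j \<in> {1, 2} \<Longrightarrow> u \<in> V j \<Longrightarrow> v \<in> V j \<Longrightarrow> h \<in> X \<Longrightarrow>
      B (L j (a *\<^sub>R u + b *\<^sub>R v)) h = B (\<lambda>x. a * L j u x + b * L j v x) h"
  shows "coupled_form V (\<lambda>i j u w. B (L j u) (L i w))"
proof
  fix u w assume "u \<in> V 1" "w \<in> V 2"
  then have mem: "L 1 u \<in> X" "L 2 w \<in> X" using L_mem by auto
  \<comment> \<open>Positivity on pairs is positivity of \<open>B\<close> at the sum of the two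
    images, expanded bilinearly.\<close>
  let ?s = "\<lambda>x. L 1 u x + L 2 w x"
  have s: "?s \<in> X" using X[OF mem, of 1 1] by simp
  have "B ?s ?s = B (L 1 u) ?s + B (L 2 w) ?s"
    using B_lincomb[OF mem s, of 1 1] by simp
  also have "B (L 1 u) ?s = B (L 1 u) (L 1 u) + B (L 1 u) (L 2 w)"
    using B_lincomb[OF mem mem(1), of 1 1] by (simp add: B_commute[of "L 1 u" ?s] B_commute[of "L 2 w" "L 1 u"])
  also have "B (L 2 w) ?s = B (L 1 u) (L 2 w) + B (L 2 w) (L 2 w)"
    using B_lincomb[OF mem mem(2), of 1 1] by (simp add: B_commute[of "L 2 w" ?s])
  finally show "0 \<le> B (L 1 u) (L 1 u) + 2 * B (L 1 u) (L 2 w) + B (L 2 w) (L 2 w)"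
    using B_nonneg[of ?s] by simp
next
  fix i j u v w a b assume *: "i \<in> {1, 2}" "j \<in> {1, 2}" "u \<in> V j" "v \<in> V j" "w \<in> V i"
  then show "B (L j (a *\<^sub>R u + b *\<^sub>R v)) (L i w) = a * B (L j u) (L i w) + b * B (L j v) (L i w)"
    by (simp add: L_lincomb B_lincomb L_mem)
qed (simp_all add: V B_commute)

text \<open>Here \<open>x\<close>, \<open>y\<close>, \<open>z\<close> are the iterates at three
  consecutive time levels, from oldest to newest; \<open>cfl\<close> is the step size restriction
  with the infimum already unfolded.\<close>

lemma energy_step:
  fixes x y z :: "nat \<Rightarrow> 'v::real_vector"
  assumes m: "coupled_form V m" and a: "coupled_form V a" and c: "coupled_form V c"
    and \<tau>: "0 < \<tau>"
    and \<gamma>: "\<gamma>\<^sup>2 \<le> 1" "\<And>u w. u \<in> V 1 \<Longrightarrow> w \<in> V 2 \<Longrightarrow> \<bar>m 2 1 u w\<bar> \<le> \<gamma> * (sqrt (m 1 1 u u) * sqrt (m 2 2 w w))"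
    and cfl: "\<And>w. w \<in> V 2 \<Longrightarrow> \<tau> * a 2 2 w w \<le> (1 - \<gamma>\<^sup>2) * m 2 2 w w"
    and mem: "\<And>j. j \<in> {1, 2} \<Longrightarrow> x j \<in> V j" "\<And>j. j \<in> {1, 2} \<Longrightarrow> y j \<in> V j" "\<And>j. j \<in> {1, 2} \<Longrightarrow> z j \<in> V j"
    and eq1: "\<And>w. w \<in> V 1 \<Longrightarrow> m 1 1 ((z 1 - y 1) /\<^sub>R \<tau>) w + m 1 2 ((y 2 - x 2) /\<^sub>R \<tau>) w
      + a 1 1 (z 1) w + a 1 2 (y 2) w + c 1 1 (z 1) w + c 1 2 (z 2) w = 0"
    and eq2: "\<And>w. w \<in> V 2 \<Longrightarrow> m 2 2 ((z 2 - y 2) /\<^sub>R \<tau>) w + m 2 1 ((y 1 - x 1) /\<^sub>R \<tau>) w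
      + a 2 1 (z 1) w + a 2 2 (y 2) w + c 2 1 (z 1) w + c 2 2 (z 2) w = 0"
  shows "\<gamma>\<^sup>2 / \<tau> * (\<Sum>i\<in>{1, 2}. m i i (z i - y i) (z i - y i))
      + (\<Sum>i\<in>{1, 2}. \<Sum>j\<in>{1, 2}. a i j (z j) (z i)) + (\<Sum>i\<in>{1, 2}. \<Sum>j\<in>{1, 2}. c i j (z j) (z i))
    \<le> \<gamma>\<^sup>2 / \<tau> * (\<Sum>i\<in>{1, 2}. m i i (y i - x i) (y i - x i))
      + (\<Sum>i\<in>{1, 2}. \<Sum>j\<in>{1, 2}. a i j (y j) (y i)) + (\<Sum>i\<in>{1, 2}. \<Sum>j\<in>{1, 2}. c i j (y j) (y i))"
proof -
  interpret m: coupled_form V m by (rule m)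
  interpret a: coupled_form V a by (rule a)
  interpret c: coupled_form V c by (rule c)
  note x = mem(1)[of 1, simplified] mem(1)[of 2, simplified]
  note y = mem(2)[of 1, simplified] mem(2)[of 2, simplified]
  note z = mem(3)[of 1, simplified] mem(3)[of 2, simplified]
  define d1 d2 e1 e2 where "d1 = z 1 - y 1" and "d2 = z 2 - y 2" and "e1 = y 1 - x 1" and "e2 = y 2 - x 2"
  have mem_d: "d1 \<in> V 1" "d2 \<in> V 2" "e1 \<in> V 1" "e2 \<in> V 2"
    unfolding d1_def d2_def e1_def e2_def using x y z m.subspace_V by (simp_all add: subspace_diff)
  \<comment> \<open>These are the mass terms of the two equations tested with the new
    increments.\<close>
  define p1 p2 where "p1 = (m 1 1 d1 d1 + m 1 2 e2 d1) / \<tau>" and "p2 = (m 2 2 d2 d2 + m 2 1 e1 d2) / \<tau>"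
  \<comment> \<open>The factor \<open>\<gamma>\<close> is kept with \<open>p\<close>, the slot of
    the old increment, so that the bound reproduces the weight \<open>\<gamma>\<^sup>2\<close> of
    the energy at the previous level.\<close>
  have young: "2 * (\<gamma> * (sqrt p * sqrt q)) \<le> \<gamma>\<^sup>2 * p + q" if "0 \<le> p" "0 \<le> q" for p q
    using sum_squares_bound[of "\<gamma> * sqrt p" "sqrt q"] that by (simp add: power_mult_distrib mult.assoc)
  note nonneg = m.diag_nonneg[of 1, simplified] m.diag_nonneg[of 2, simplified]
  have cross1: "- (2 * m 1 2 e2 d1) \<le> \<gamma>\<^sup>2 * m 2 2 e2 e2 + m 1 1 d1 d1"
    using \<gamma>(2)[of d1 e2] young[of "m 2 2 e2 e2" "m 1 1 d1 d1"] nonneg mem_d m.sym[of 1 2 e2 d1]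
    by (simp add: mult.commute)
  have cross2: "- (2 * m 2 1 e1 d2) \<le> \<gamma>\<^sup>2 * m 1 1 e1 e1 + m 2 2 d2 d2"
    using \<gamma>(2)[of e1 d2] young[of "m 1 1 e1 e1" "m 2 2 d2 d2"] nonneg mem_d by simp
  have t1: "p1
      + a 1 1 (z 1) d1 + a 1 2 (y 2) d1 + c 1 1 (z 1) d1 + c 1 2 (z 2) d1 = 0"
    using eq1[OF mem_d(1)] mem_d
    by (simp add: p1_def m.scale_left divide_inverse_commute distrib_left flip: d1_def e2_def)
  have t2: "p2
      + a 2 1 (z 1) d2 + a 2 2 (y 2) d2 + c 2 1 (z 1) d2 + c 2 2 (z 2) d2 = 0"
    using eq2[OF mem_d(2)] mem_d
    by (simp add: p2_def m.scale_left divide_inverse_commute distrib_left flip: d2_def e1_def)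
  \<comment> \<open>Both components are implicit in \<open>c\<close>, so this is 2 c(z, z - y) =
    c(z, z) - c(y, y) + c(z - y, z - y) on pairs.\<close>
  have c_id: "2 * (c 1 1 (z 1) d1 + c 1 2 (z 2) d1 + c 2 1 (z 1) d2 + c 2 2 (z 2) d2)
    = (c 1 1 (z 1) (z 1) + c 1 2 (z 2) (z 1) + c 2 1 (z 1) (z 2) + c 2 2 (z 2) (z 2))
    - (c 1 1 (y 1) (y 1) + c 1 2 (y 2) (y 1) + c 2 1 (y 1) (y 2) + c 2 2 (y 2) (y 2))
    + (c 1 1 d1 d1 + 2 * c 2 1 d1 d2 + c 2 2 d2 d2)"
    unfolding d1_def d2_def using y z m.subspace_V
    by (simp add: c.diff_left c.diff_right subspace_diff c.sym[of 1 2] c.sym[of 1 1 "y 1" "z 1"] c.sym[of 2 2 "y 2" "z 2"])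
  \<comment> \<open>The first component enters as \<open>z 1\<close> and the second as
    \<open>y 2\<close>. The mixed terms then telescope exactly, and the explicit second component
    contributes its square with a negative sign.\<close>
  have a_id: "2 * (a 1 1 (z 1) d1 + a 1 2 (y 2) d1 + a 2 1 (z 1) d2 + a 2 2 (y 2) d2)
    = (a 1 1 (z 1) (z 1) + a 1 2 (z 2) (z 1) + a 2 1 (z 1) (z 2) + a 2 2 (z 2) (z 2))
    - (a 1 1 (y 1) (y 1) + a 1 2 (y 2) (y 1) + a 2 1 (y 1) (y 2) + a 2 2 (y 2) (y 2))
    + (a 1 1 d1 d1 - a 2 2 d2 d2)"
    unfolding d1_def d2_def using y z m.subspace_V
    by (simp add: a.diff_left a.diff_right subspace_diff a.sym[of 1 2] a.sym[of 1 1 "y 1" "z 1"] a.sym[of 2 2 "y 2" "z 2"])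
  have c_pos: "0 \<le> c 1 1 d1 d1 + 2 * c 2 1 d1 d2 + c 2 2 d2 d2" using c.pair_nonneg mem_d by simp
  have a_pos: "0 \<le> a 1 1 d1 d1" using a.diag_nonneg mem_d by simp
  \<comment> \<open>After Young's inequality one copy of each new mass norm remains. Lowering its
    weight to \<open>\<gamma>\<^sup>2\<close> leaves a reserve in the second component, which
    \<open>cfl\<close> turns into a bound for \<open>a 2 2 d2 d2\<close>.\<close>
  have mass: "\<gamma>\<^sup>2 / \<tau> * (m 1 1 d1 d1 + m 2 2 d2 d2) + a 2 2 d2 d2 \<le> \<gamma>\<^sup>2 / \<tau> * (m 1 1 e1 e1 + m 2 2 e2 e2) + 2 * p1 + 2 * p2"
  proof -
    have "\<gamma>\<^sup>2 * m 1 1 d1 d1 \<le> m 1 1 d1 d1" using \<gamma>(1) nonneg mem_d by (simp add: mult_left_le_one_le)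
    moreover have "\<tau> * a 2 2 d2 d2 + \<gamma>\<^sup>2 * m 2 2 d2 d2 \<le> m 2 2 d2 d2"
      using cfl[OF mem_d(2)] by (simp add: left_diff_distrib)
    ultimately have "\<gamma>\<^sup>2 * (m 1 1 d1 d1 + m 2 2 d2 d2) + \<tau> * a 2 2 d2 d2
      \<le> \<gamma>\<^sup>2 * (m 1 1 e1 e1 + m 2 2 e2 e2) + 2 * (m 1 1 d1 d1 + m 1 2 e2 d1) + 2 * (m 2 2 d2 d2 + m 2 1 e1 d2)"
      using cross1 cross2 by (simp add: distrib_left)
    from divide_right_mono[OF this, of \<tau>] show ?thesis
      unfolding p1_def p2_def using \<tau> by (simp add: add_divide_distrib distrib_left)
  qed
  have "\<gamma>\<^sup>2 / \<tau> * (m 1 1 d1 d1 + m 2 2 d2 d2)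
    + (a 1 1 (z 1) (z 1) + a 1 2 (z 2) (z 1) + a 2 1 (z 1) (z 2) + a 2 2 (z 2) (z 2))
    + (c 1 1 (z 1) (z 1) + c 1 2 (z 2) (z 1) + c 2 1 (z 1) (z 2) + c 2 2 (z 2) (z 2))
    \<le> \<gamma>\<^sup>2 / \<tau> * (m 1 1 e1 e1 + m 2 2 e2 e2)
    + (a 1 1 (y 1) (y 1) + a 1 2 (y 2) (y 1) + a 2 1 (y 1) (y 2) + a 2 2 (y 2) (y 2))
    + (c 1 1 (y 1) (y 1) + c 1 2 (y 2) (y 1) + c 2 1 (y 1) (y 2) + c 2 2 (y 2) (y 2))"
    \<comment> \<open>The sum of \<open>t1\<close> and \<open>t2\<close>, doubled, eliminates
      \<open>p1\<close> and \<open>p2\<close>; the terms \<open>a 2 2 d2 d2\<close> from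
      \<open>mass\<close> and \<open>a_id\<close> cancel, and the nonnegative remainders are
      dropped.\<close>
    using mass t1 t2 c_id a_id c_pos a_pos by argo
  then show ?thesis unfolding d1_def d2_def e1_def e2_def by (simp add: add.assoc)
qed

section \<open>The multicontinuum forms\<close>

lemma macro_spaceD: "U \<in> macro_space D j \<Longrightarrow> i \<in> group D j \<Longrightarrow> U i \<in> smooth_fns D"
  by (simp add: macro_space_def)

lemma discrete_spaceD:
  assumes "discrete_space D j V"
  shows "subspace V" and "U \<in> V \<Longrightarrow> U \<in> macro_space D j" and "U \<in> V \<Longrightarrow> T D j U \<in> L2 (domain D)"
    and "U \<in> V \<Longrightarrow> T0 D j U \<in> broken_H1 (mesh D)" and "U \<in> V \<Longrightarrow> T1 D j U \<in> broken_H1 (mesh D)"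
  using assms unfolding discrete_space_def by (auto simp: subspace_span)

lemma T0_lincomb: "T0 D j (a *\<^sub>R U + b *\<^sub>R W) = (\<lambda>x. a * T0 D j U x + b * T0 D j W x)"
  by (simp add: T0_def fun_eq_iff scaleR_fun_def sum_distrib_left sum.distrib algebra_simps)

section \<open>Blocks inside the domain and linearity of the downscaling maps\<close>

context multicontinuum
begin

lemma domain_open: "open (domain D)" and domain_lmeasurable: "domain D \<in> lmeasurable"
  using domain lmeasurable_open unfolding polygonal_domain_def by auto

text \<open>A block is given only as a subset of the closure of the domain. That closure lies in the
  closed union of polytopes whose interior is the domain, so taking interiors leads back into the
  domain.\<close>

lemma interior_block_subset:
  assumes "K \<in> mesh D"
  shows "interior K \<subseteq> domain D"
proof -
  obtain P where P: "finite P" "\<forall>p\<in>P. polytope p" "domain D = interior (\<Union>P)"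
    using domain unfolding polygonal_domain_def by auto
  have "closed (\<Union>P)" using P by (intro closed_Union) (auto intro: polytope_imp_closed)
  then have "closure (domain D) \<subseteq> \<Union>P"
    unfolding P(3) by (intro closure_minimal interior_subset)
  moreover have "K \<subseteq> closure (domain D)" using mesh assms unfolding regular_mesh_def by auto
  ultimately show ?thesis unfolding P(3) by (intro interior_mono) auto
qed

text \<open>Linearity of \<open>T1\<close> is obtained almost everywhere on the domain, whereas
  energies are integrated over block interiors; this connects the two.\<close>

lemma AE_domain_imp_AE_block:
  assumes "AE x in lebesgue_on (domain D). P x" "K \<in> mesh D"
  shows "AE x in lebesgue_on (interior K). P x"
proof -
  have sets: "domain D \<in> sets lebesgue" "interior K \<in> sets lebesgue"
    using domain_open by auto
  have "AE x in lebesgue. x \<in> domain D \<longrightarrow> P x"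
    using assms(1) sets by (simp add: AE_restrict_space_iff)
  then have "AE x in lebesgue. x \<in> interior K \<longrightarrow> P x"
    by eventually_elim (use interior_block_subset[OF assms(2)] in auto)
  then show ?thesis using sets by (simp add: AE_restrict_space_iff)
qed

lemma ex_broken_coefficient: "\<exists>B. broken_coefficient (kappa D) (mesh D) B"
proof -
  obtain l B where k: "0 < l" "\<forall>x\<in>domain D. l \<le> kappa D x \<and> kappa D x \<le> B"
    using kappa_bounds by blast
  have "broken_coefficient (kappa D) (mesh D) B"
  proof
    fix K assume K: "K \<in> mesh D"
    note sub = interior_block_subset[OF K]
    show "interior K \<in> lmeasurable"
      using bounded_subset[OF _ sub] domain unfolding polygonal_domain_def
      by (intro lmeasurable_open) auto
    show "kappa D \<in> borel_measurable (lebesgue_on (interior K))"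
      by (rule measurable_restrict_mono[OF kappa_measurable sub])
    show "0 \<le> kappa D x \<and> kappa D x \<le> B" if "x \<in> interior K" for x
      using k sub that by force
  qed
  then show ?thesis ..
qed

lemma finite_group: "j \<in> {1, 2} \<Longrightarrow> finite (group D j)"
  using groups(2) by (metis finite_Un finite_atLeastAtMost insertE singletonD)

text \<open>\<open>T1\<close> depends on its argument through chosen weak gradients, each linear off
  a null set; a group is finite, so one null set serves all its continua.\<close>

lemma T1_lincomb_AE:
  assumes j: "j \<in> {1, 2}" and U: "U \<in> macro_space D j" and W: "W \<in> macro_space D j"
  shows "AE x in lebesgue_on (domain D). T1 D j (a *\<^sub>R U + b *\<^sub>R W) x = a * T1 D j U x + b * T1 D j W x"
proof -
  have "AE x in lebesgue_on (domain D). \<forall>i\<in>group D j.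
      weak_grad (domain D) ((a *\<^sub>R U + b *\<^sub>R W) i) x
      = a *\<^sub>R weak_grad (domain D) (U i) x + b *\<^sub>R weak_grad (domain D) (W i) x"
  proof (intro AE_finite_allI finite_group j)
    fix i assume i: "i \<in> group D j"
    have "(a *\<^sub>R U + b *\<^sub>R W) i = (\<lambda>x. a * U i x + b * W i x)"
      by (simp add: fun_eq_iff scaleR_fun_def)
    moreover have "U i \<in> H1 (domain D)" "W i \<in> H1 (domain D)"
      using macro_spaceD[OF U i] macro_spaceD[OF W i] smooth_fns(2) by auto
    ultimately show "AE x in lebesgue_on (domain D). weak_grad (domain D) ((a *\<^sub>R U + b *\<^sub>R W) i) x
        = a *\<^sub>R weak_grad (domain D) (U i) x + b *\<^sub>R weak_grad (domain D) (W i) x"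
      using weak_grad_lincomb[OF domain_open domain_lmeasurable] by simp
  qed
  then show ?thesis
  proof (rule AE_mp, intro AE_I2 impI)
    fix x assume "\<forall>i\<in>group D j. weak_grad (domain D) ((a *\<^sub>R U + b *\<^sub>R W) i) x
        = a *\<^sub>R weak_grad (domain D) (U i) x + b *\<^sub>R weak_grad (domain D) (W i) x"
    then show "T1 D j (a *\<^sub>R U + b *\<^sub>R W) x = a * T1 D j U x + b * T1 D j W x"
      by (simp add: T1_def inner_add_right sum_distrib_left sum.distrib algebra_simps cong: sum.cong)
  qed
qed

lemma T_lincomb_AE:
  assumes "j \<in> {1, 2}" "U \<in> macro_space D j" "W \<in> macro_space D j"
  shows "AE x in lebesgue_on (domain D). T D j (a *\<^sub>R U + b *\<^sub>R W) x = a * T D j U x + b * T D j W x"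
  using T1_lincomb_AE[OF assms, of a b]
  by eventually_elim (simp add: T_def T0_lincomb algebra_simps)

section \<open>The forms on the discrete spaces, the constant gamma and the step bound\<close>

context
  fixes VH :: "nat \<Rightarrow> (nat \<Rightarrow> real^'n \<Rightarrow> real) set"
  assumes VH: "\<And>j. j \<in> {1, 2} \<Longrightarrow> discrete_space D j (VH j)"
begin

lemma VH_lincomb: "j \<in> {1, 2} \<Longrightarrow> U \<in> VH j \<Longrightarrow> W \<in> VH j \<Longrightarrow> a *\<^sub>R U + b *\<^sub>R W \<in> VH j"
  using discrete_spaceD(1)[OF VH] by (simp add: subspace_add subspace_scale)

lemma coupled_m_form: "coupled_form VH (m_form D)"
proof -
  have "coupled_form VH (\<lambda>i j U W. L2_inner (domain D) (T D j U) (T D i W))"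
  proof (rule coupled_formI[where X = "L2 (domain D)"])
    show "subspace (VH j)" if "j \<in> {1, 2}" for j by (rule discrete_spaceD(1)[OF VH[OF that]])
    show "(\<lambda>x. a * f x + b * g x) \<in> L2 (domain D)" if "f \<in> L2 (domain D)" "g \<in> L2 (domain D)" for f g and a b :: real
      using L2_lincomb[OF that, of a b] by simp
    show "T D j U \<in> L2 (domain D)" if "j \<in> {1, 2}" "U \<in> VH j" for j U
      by (rule discrete_spaceD(3)[OF VH[OF that(1)] that(2)])
    show "L2_inner (domain D) (T D j (a *\<^sub>R U + b *\<^sub>R W)) h = L2_inner (domain D) (\<lambda>x. a * T D j U x + b * T D j W x) h"
      if j: "j \<in> {1, 2}" and U: "U \<in> VH j" and W: "W \<in> VH j" and h: "h \<in> L2 (domain D)" for j U W h a b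
    proof (rule L2_inner_cong_AE[OF _ _ h])
      note d = discrete_spaceD[OF VH[OF j]]
      show "T D j (a *\<^sub>R U + b *\<^sub>R W) \<in> L2 (domain D)" by (intro d(3) VH_lincomb j U W)
      show "(\<lambda>x. a * T D j U x + b * T D j W x) \<in> L2 (domain D)"
        using L2_lincomb[OF d(3)[OF U] d(3)[OF W], of a b] by simp
      show "AE x in lebesgue_on (domain D). T D j (a *\<^sub>R U + b *\<^sub>R W) x = a * T D j U x + b * T D j W x"
        by (intro T_lincomb_AE j d(2) U W)
    qed
  qed (fact L2_inner_lincomb L2_inner_commute L2_inner_self_nonneg)+
  then show ?thesis unfolding m_form_def .
qed

text \<open>Treats a and c together, with \<open>L\<close> standing for \<open>T1\<close> or
  \<open>T0\<close>.\<close>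

lemma coupled_energy_form:
  assumes mem: "\<And>j U. j \<in> {1, 2} \<Longrightarrow> U \<in> VH j \<Longrightarrow> L j U \<in> broken_H1 (mesh D)"
    and lincomb: "\<And>j U W a b. j \<in> {1, 2} \<Longrightarrow> U \<in> VH j \<Longrightarrow> W \<in> VH j \<Longrightarrow>
      AE x in lebesgue_on (domain D). L j (a *\<^sub>R U + b *\<^sub>R W) x = a * L j U x + b * L j W x"
  shows "coupled_form VH (\<lambda>i j U W. broken_energy (kappa D) (mesh D) (L j U) (L i W))"
proof -
  obtain B where "broken_coefficient (kappa D) (mesh D) B" using ex_broken_coefficient ..
  then interpret broken_coefficient "kappa D" "mesh D" B .
  show ?thesis
  proof (rule coupled_formI[where X = "broken_H1 (mesh D)"])
    show "subspace (VH j)" if "j \<in> {1, 2}" for j by (rule discrete_spaceD(1)[OF VH[OF that]])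
    show "broken_energy (kappa D) (mesh D) (L j (a *\<^sub>R U + b *\<^sub>R W)) h
        = broken_energy (kappa D) (mesh D) (\<lambda>x. a * L j U x + b * L j W x) h"
      if "j \<in> {1, 2}" "U \<in> VH j" "W \<in> VH j" for j U W h a b
      using that
      by (intro broken_energy_cong_AE mem broken_H1_lincomb VH_lincomb AE_domain_imp_AE_block[OF lincomb])
  qed (fact mem broken_H1_lincomb broken_energy_lincomb broken_energy_commute broken_energy_self_nonneg)+
qed

lemma coupled_a_form: "coupled_form VH (a_form D)"
  unfolding a_form_def
  by (intro coupled_energy_form T1_lincomb_AE discrete_spaceD(5)[OF VH] discrete_spaceD(2)[OF VH])

lemma coupled_c_form: "coupled_form VH (c_form D)"
  unfolding c_form_def
  by (intro coupled_energy_form discrete_spaceD(4)[OF VH]) (simp_all add: T0_lincomb)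

text \<open>The quotients defining \<open>gamma\<close> lie in [-1, 1] by Cauchy-Schwarz, and
  replacing U by -U negates them. Their supremum therefore also bounds their absolute
  values.\<close>

lemma gamma_Cauchy_Schwarz:
  assumes U: "U \<in> VH 1" and W: "W \<in> VH 2"
  shows "\<bar>m_form D 2 1 U W\<bar> \<le> gamma D (VH 1) (VH 2) * (sqrt (m_form D 1 1 U U) * sqrt (m_form D 2 2 W W))"
    and "(gamma D (VH 1) (VH 2))\<^sup>2 \<le> 1"
proof -
  interpret m: coupled_form VH "m_form D" by (rule coupled_m_form)
  let ?d = "\<lambda>U W. sqrt (m_form D 1 1 U U) * sqrt (m_form D 2 2 W W)"
  define Q where "Q = {m_form D 2 1 U W / ?d U W | U W. U \<in> VH 1 \<and> W \<in> VH 2 \<and> ?d U W \<noteq> 0}"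
  have gamma: "gamma D (VH 1) (VH 2) = (if Q = {} then 0 else Sup Q)"
    unfolding gamma_def Q_def L2_norm_def m_form_def Let_def by simp
  have CS: "\<bar>m_form D 2 1 U W\<bar> \<le> ?d U W" if "U \<in> VH 1" "W \<in> VH 2" for U W
    using real_sqrt_le_mono[OF m.Cauchy_Schwarz[OF that]] by (simp add: real_sqrt_mult)
  have d_nonneg: "0 \<le> ?d U W" if "U \<in> VH 1" "W \<in> VH 2" for U W
    using CS[OF that] by linarith
  have Q_le: "\<bar>q\<bar> \<le> 1" if "q \<in> Q" for q
    using that CS d_nonneg unfolding Q_def by (fastforce simp: abs_divide divide_le_eq_1)
  have bdd: "bdd_above Q" using Q_le by (intro bdd_aboveI[of _ 1]) fastforce
  have uminus: "- q \<in> Q" if qQ: "q \<in> Q" for q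
  proof -
    obtain U W where q: "U \<in> VH 1" "W \<in> VH 2" "?d U W \<noteq> 0" "q = m_form D 2 1 U W / ?d U W"
      using qQ unfolding Q_def by blast
    have "- U \<in> VH 1" using m.subspace_V[of 1] q(1) by (simp add: subspace_neg)
    moreover from this have "m_form D 2 1 (- U) W = - m_form D 2 1 U W" "m_form D 1 1 (- U) (- U) = m_form D 1 1 U U"
      using m.scale_left[of 2 1 U W "-1"] m.scale_left[of 1 1 U U "-1"] m.scale_left[of 1 1 U "-U" "-1"]
        m.sym[of 1 1 U "- U"] q by simp_all
    ultimately show ?thesis using q unfolding Q_def mem_Collect_eq by (intro exI[of _ "- U"] exI[of _ W]) simp
  qed
  show "(gamma D (VH 1) (VH 2))\<^sup>2 \<le> 1"
  proof (cases "Q = {}")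
    case False
    then obtain q where q: "q \<in> Q" by blast
    have "Sup Q \<le> 1" using False Q_le by (intro cSup_least) (auto simp: abs_le_iff)
    \<comment> \<open>The square of the supremum is to be bounded, so a lower bound is required
      too.\<close>
    moreover have "-1 \<le> Sup Q" using cSup_upper[OF q bdd] Q_le[OF q] by linarith
    ultimately show ?thesis using False gamma by (simp add: abs_square_le_1 abs_le_iff)
  qed (simp add: gamma)
  show "\<bar>m_form D 2 1 U W\<bar> \<le> gamma D (VH 1) (VH 2) * ?d U W"
  proof (cases "?d U W = 0")
    \<comment> \<open>Pairs with zero denominator are absent from \<open>Q\<close>; for them
      Cauchy-Schwarz itself makes the numerator vanish.\<close>
    case True
    then show ?thesis using CS[OF U W] unfolding True by simp
  next
    case False
    let ?q = "m_form D 2 1 U W / ?d U W"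
    have q: "?q \<in> Q" using U W False unfolding Q_def by blast
    then have "\<bar>?q\<bar> \<le> Sup Q"
      using cSup_upper[OF q bdd] cSup_upper[OF uminus[OF q] bdd] by linarith
    moreover have "0 < ?d U W" using d_nonneg[OF U W] False by linarith
    ultimately have "\<bar>m_form D 2 1 U W\<bar> \<le> Sup Q * ?d U W"
      by (simp add: abs_divide pos_divide_le_eq)
    then show ?thesis using gamma q by auto
  qed
qed

text \<open>If the a-norm of \<open>W\<close> is nonzero, its quotient dominates the infimum, and
  multiplication by 1 - g^2 \<ge> 0 is monotone in the extended reals. Otherwise the left side is 0
  and the right side nonnegative.\<close>

lemma step_bound_inf_quotient:
  assumes g: "g\<^sup>2 \<le> 1" and \<tau>: "ereal \<tau> \<le> ereal (1 - g\<^sup>2) * inf_quotient D (VH 2)" and W: "W \<in> VH 2"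
  shows "\<tau> * a_form D 2 2 W W \<le> (1 - g\<^sup>2) * m_form D 2 2 W W"
proof -
  interpret m: coupled_form VH "m_form D" by (rule coupled_m_form)
  interpret a: coupled_form VH "a_form D" by (rule coupled_a_form)
  have nonneg: "0 \<le> m_form D 2 2 W W" "0 \<le> a_form D 2 2 W W"
    using m.diag_nonneg[of 2 W] a.diag_nonneg[of 2 W] W by auto
  show ?thesis
  proof (cases "a_form D 2 2 W W = 0")
    case True
    then show ?thesis using nonneg g by simp
  next
    case False
    have "inf_quotient D (VH 2) \<le> ereal (m_form D 2 2 W W / a_form D 2 2 W W)"
      unfolding inf_quotient_def using W False
      by (intro INF_lower2[of W]) (simp_all add: m_norm2_def a_norm2_def)
    then have "ereal (1 - g\<^sup>2) * inf_quotient D (VH 2)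
        \<le> ereal (1 - g\<^sup>2) * ereal (m_form D 2 2 W W / a_form D 2 2 W W)"
      using g by (intro ereal_mult_left_mono) simp_all
    then have "ereal \<tau> \<le> ereal ((1 - g\<^sup>2) * (m_form D 2 2 W W / a_form D 2 2 W W))"
      using order_trans[OF \<tau>] by (metis times_ereal.simps(1))
    then show ?thesis using False nonneg(2) by (simp add: pos_le_divide_eq)
  qed
qed

end

end

theorem theorem2:
  fixes D :: "'n::finite mc_data"
    and VH :: "nat \<Rightarrow> (nat \<Rightarrow> real^'n \<Rightarrow> real) set"
    and U :: "nat \<Rightarrow> nat \<Rightarrow> nat \<Rightarrow> real^'n \<Rightarrow> real"
    and \<tau> :: real
  defines "\<gamma> \<equiv> gamma D (VH 1) (VH 2)"
  assumes "multicontinuum D"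
    and "direct_sum_V D"
    and "discrete_space D 1 (VH 1)" and "discrete_space D 2 (VH 2)"
    and "\<tau> > 0"
    and "\<And>n. U n 1 \<in> VH 1" and "\<And>n. U n 2 \<in> VH 2"
    and "\<And>n W. n \<ge> 1 \<Longrightarrow> W \<in> VH 1 \<Longrightarrow>
           m_form D 1 1 ((U (n+1) 1 - U n 1) /\<^sub>R \<tau>) W + m_form D 1 2 ((U n 2 - U (n-1) 2) /\<^sub>R \<tau>) W
           + a_form D 1 1 (U (n+1) 1) W + a_form D 1 2 (U n 2) W
           + c_form D 1 1 (U (n+1) 1) W + c_form D 1 2 (U (n+1) 2) W = 0"
    and "\<And>n W. n \<ge> 1 \<Longrightarrow> W \<in> VH 2 \<Longrightarrow>
           m_form D 2 2 ((U (n+1) 2 - U n 2) /\<^sub>R \<tau>) W + m_form D 2 1 ((U n 1 - U (n-1) 1) /\<^sub>R \<tau>) W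
           + a_form D 2 1 (U (n+1) 1) W + a_form D 2 2 (U n 2) W
           + c_form D 2 1 (U (n+1) 1) W + c_form D 2 2 (U (n+1) 2) W = 0"
    and "ereal \<tau> \<le> ereal (1 - \<gamma>\<^sup>2) * inf_quotient D (VH 2)"
  shows "\<forall>n\<ge>1.
           \<gamma>\<^sup>2 / \<tau> * (\<Sum>i\<in>{1, 2}. m_norm2 D i (U (n+1) i - U n i))
             + a_pair_norm2 D (U (n+1)) + c_pair_norm2 D (U (n+1))
           \<le> \<gamma>\<^sup>2 / \<tau> * (\<Sum>i\<in>{1, 2}. m_norm2 D i (U n i - U (n-1) i))
             + a_pair_norm2 D (U n) + c_pair_norm2 D (U n)"
proof (intro allI impI)
  fix n :: nat assume n: "1 \<le> n"
  interpret multicontinuum D by fact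
  have VH: "discrete_space D j (VH j)" if "j \<in> {1, 2}" for j
    using that assms(4,5) by auto
  have U: "U k j \<in> VH j" if "j \<in> {1, 2}" for k j
    using that assms(7,8) by auto
  have "\<gamma>\<^sup>2 \<le> 1"
    unfolding \<gamma>_def by (rule gamma_Cauchy_Schwarz(2)[OF VH assms(7,8)])
  show "\<gamma>\<^sup>2 / \<tau> * (\<Sum>i\<in>{1, 2}. m_norm2 D i (U (n+1) i - U n i))
             + a_pair_norm2 D (U (n+1)) + c_pair_norm2 D (U (n+1))
           \<le> \<gamma>\<^sup>2 / \<tau> * (\<Sum>i\<in>{1, 2}. m_norm2 D i (U n i - U (n-1) i))
             + a_pair_norm2 D (U n) + c_pair_norm2 D (U n)"
    unfolding m_norm2_def a_pair_norm2_def c_pair_norm2_def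
  \<comment> \<open>Since \<open>n\<close> is at least 1, the natural number \<open>n - 1\<close> is
    the true predecessor, and the scheme at \<open>n\<close> supplies both tested equations.\<close>
  proof (rule energy_step[where V = VH and m = "m_form D" and a = "a_form D" and c = "c_form D"
        and x = "U (n - 1)" and y = "U n" and z = "U (n + 1)"])
    show "coupled_form VH (m_form D)" by (rule coupled_m_form[OF VH])
    show "coupled_form VH (a_form D)" by (rule coupled_a_form[OF VH])
    show "coupled_form VH (c_form D)" by (rule coupled_c_form[OF VH])
    show "\<bar>m_form D 2 1 u w\<bar> \<le> \<gamma> * (sqrt (m_form D 1 1 u u) * sqrt (m_form D 2 2 w w))"
      if "u \<in> VH 1" "w \<in> VH 2" for u w
      unfolding \<gamma>_def by (rule gamma_Cauchy_Schwarz(1)[OF VH that])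
    show "\<tau> * a_form D 2 2 w w \<le> (1 - \<gamma>\<^sup>2) * m_form D 2 2 w w" if "w \<in> VH 2" for w
      by (rule step_bound_inf_quotient[OF VH \<open>\<gamma>\<^sup>2 \<le> 1\<close> assms(11) that])
  qed (fact \<open>\<tau> > 0\<close> \<open>\<gamma>\<^sup>2 \<le> 1\<close> U assms(9)[OF n] assms(10)[OF n])+
qed

end
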